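(* Let $\lambda\in\mathbb{R}\setminus\{0\}$. Let $\Omega\subset\mathbb{R}^{n+1}$ be a nonempty open subset, and let $I\subset\mathbb{R}\setminus\{0\}$ be a nonempty, connected, open subset. For $F\in\mathcal{A}^{\lambda}(\Omega)$ let $\Omega_I=F^{-1}(I)\cap\Omega$, and let $e\in\mathbb{R}^{n+1}$ be the axis of $F$. The following are equivalent. (1) There is a nonvanishing function $\phi:I\to\mathbb{R}$ such that $F$ solves $\mathsf{H}(F)=\phi(F)$ on $\Omega_I$. (2) For all $r\in I$ each level set $\Sigma_r(F,\Omega_I)=\{x\in\Omega_I:F(x)=r\}$, equipped with the coorientation of its components consistent with $-\operatorname{sgn}(|dF|_g^2)F^i$, is an improper affine sphere with equiaffine normal equal to $c\,e$ for a constant $c$ depending only on $r$ (and not on the connected component). When these conditions hold, there is a nonzero constant $\kappa$ such that $\phi$ has the form $\phi(r)=\kappa r^{n+1}$.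
   Context: $\mathbb{R}^{n+1}$ carries its standard flat affine connection $\partial$ and a fixed parallel volume form $\Psi$. $\mathcal{A}^{\lambda}(\Omega)$ is the set of functions $F$ continuous on $\Omega$ and smooth on $\Omega\setminus\{F=0\}$ for which there is a constant vector $e\in\mathbb{R}^{n+1}$ (the axis of $F$) such that $F(x+te)=e^{\lambda t}F(x)$ for all $t\in\mathbb{R}$ and $x\in\Omega$ with $x+te\in\Omega$ (in $e^{\lambda t}$, $e$ is the base of the exponential). The Hessian determinant $\mathsf{H}(F)$ is defined by $\det\operatorname{Hess}F=\mathsf{H}(F)\Psi^2$. Where $\mathsf{H}(F)\neq0$, $g_{ij}=F_{ij}=(\operatorname{Hess}F)_{ij}$ is a pseudo-Riemannian metric with inverse $g^{ij}$; $F_p$ denotes the components of $dF$, $F^i=g^{ip}F_p$, and $|dF|_g^2=F^pF_p$. (If a level set of $F\in\mathcal A^\lambda(\Omega)$ at a nonzero value is nondegenerate then $\mathsf{H}(F)$ and $|dF|_g^2$ do not vanish on it, so the coorientation in (2) makes sense.) $\operatorname{sgn}(t)=t/|t|$. Improper affine spheres: let $\Sigma$ be a connected coorientable immersed hypersurface in $\mathbb{R}^{n+1}$. For a transverse vector field $N$ along $\Sigma$ write, for $X,Y$ tangent to $\Sigma$, $\partial_XY=\nabla_XY+h(X,Y)N$ and $\partial_XN=-S(X)+\tau_N(X)N$ (with $\nabla_XY$, $S(X)$ tangent). $\Sigma$ is nondegenerate if $h$ is nondegenerate (a condition independent of $N$). In that case the equiaffine normal is the transverse field $W$, unique up to sign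 (the sign being fixed by a coorientation), whose connection one-form $\tau_W$ vanishes and for which the volume density of the metric $h$ determined by $W$ equals $|\iota(W)\Psi|$. A nondegenerate connected hypersurface is an improper affine sphere if its equiaffine normals are parallel. A hypersurface with several connected components, equipped with coorientations of its components, is an improper affine sphere if each component is one, the affine normal lines of all components are parallel, and, for the equiaffine normals consistent with these coorientations, the signatures modulo $4$ of the metrics $h$ on the components all agree.
   Formalization: The final formula φ(r)=κr^{n+1} is proved on each connected set J of values attained by F on Ω_I (so on all of I when every level set is nonempty); on all of I it can fail, since φ is free at unattained values and κ may differ between separate intervals of values. *)

theory Defs
  imports "HOL-Analysis.Analysis"
begin

section \<open>Smooth maps\<close>

text \<open>\<open>Ck_on k f S\<close> is used for open \<open>S\<close> only: all iterated directional derivatives of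
  \<open>f\<close> up to order \<open>k\<close> exist and are continuous on \<open>S\<close>, those of order less than \<open>k\<close> being
  Frechet differentiable.\<close>

primrec Ck_on ::
  "nat \<Rightarrow> ('a::real_normed_vector \<Rightarrow> 'b::real_normed_vector) \<Rightarrow> 'a set \<Rightarrow> bool" where
  "Ck_on 0 f S \<longleftrightarrow> continuous_on S f"
| "Ck_on (Suc k) f S \<longleftrightarrow>
     (\<forall>x\<in>S. f differentiable (at x)) \<and>
     (\<forall>v. Ck_on k (\<lambda>x. frechet_derivative f (at x) v) S)"

definition smooth_on ::
  "('a::real_normed_vector \<Rightarrow> 'b::real_normed_vector) \<Rightarrow> 'a set \<Rightarrow> bool" where
  "smooth_on f S \<longleftrightarrow> (\<forall>k. Ck_on k f S)"


section \<open>Parallel volume forms and the Hessian determinant\<close>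

text \<open>A family \<open>v\<close> of vectors indexed by \<open>'m\<close> is an element of \<open>real^'m^'m\<close> with members
  \<open>v $ i\<close>. With respect to the flat connection, a form is parallel iff it does not depend on the
  base point, so a parallel volume form is one nonzero alternating form of top degree.\<close>

definition parallel_volume_form :: "((real^'m)^'m \<Rightarrow> real) \<Rightarrow> bool" where
  "parallel_volume_form \<Psi> \<longleftrightarrow>
     (\<forall>v i. linear (\<lambda>x. \<Psi> (\<chi> j. if j = i then x else v $ j))) \<and>
     (\<forall>v i j. i \<noteq> j \<longrightarrow> v $ i = v $ j \<longrightarrow> \<Psi> v = 0) \<and>
     (\<exists>v. \<Psi> v \<noteq> 0)"

definition hess :: "(real^'m \<Rightarrow> real) \<Rightarrow> real^'m \<Rightarrow> real^'m \<Rightarrow> real^'m \<Rightarrow> real" where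
  "hess F x u v = frechet_derivative (\<lambda>y. frechet_derivative F (at y) v) (at x) u"

text \<open>The defining relation \<open>det Hess F = H(F) \<Psi>\<^sup>2\<close>, evaluated on all families \<open>v\<close>.\<close>

definition hess_det :: "((real^'m)^'m \<Rightarrow> real) \<Rightarrow> (real^'m \<Rightarrow> real) \<Rightarrow> real^'m \<Rightarrow> real" where
  "hess_det \<Psi> F x =
     (THE c. \<forall>v. det (\<chi> i j. hess F x (v $ i) (v $ j)) = c * (\<Psi> v)\<^sup>2)"

text \<open>Components \<open>F\<^sub>p\<close>, \<open>g\<^sub>i\<^sub>j = F\<^sub>i\<^sub>j\<close>, \<open>F\<^sup>i = g\<^sup>i\<^sup>p F\<^sub>p\<close> and \<open>F\<^sup>p F\<^sub>p\<close>
  in the standard coordinates; the last two are meaningful only where the Hessian is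
  nondegenerate.\<close>

definition dcomp :: "(real^'m \<Rightarrow> real) \<Rightarrow> real^'m \<Rightarrow> real^'m" where
  "dcomp F x = (\<chi> p. frechet_derivative F (at x) (axis p 1))"

definition hess_matrix :: "(real^'m \<Rightarrow> real) \<Rightarrow> real^'m \<Rightarrow> real^'m^'m" where
  "hess_matrix F x = (\<chi> i j. hess F x (axis i 1) (axis j 1))"

definition raised_differential :: "(real^'m \<Rightarrow> real) \<Rightarrow> real^'m \<Rightarrow> real^'m" where
  "raised_differential F x = matrix_inv (hess_matrix F x) *v dcomp F x"

definition norm2_differential :: "(real^'m \<Rightarrow> real) \<Rightarrow> real^'m \<Rightarrow> real" where
  "norm2_differential F x = (\<Sum>p\<in>UNIV. raised_differential F x $ p * dcomp F x $ p)"


section \<open>The class of translationally homogeneous functions\<close>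

definition is_axis :: "real \<Rightarrow> (real^'m) set \<Rightarrow> (real^'m \<Rightarrow> real) \<Rightarrow> real^'m \<Rightarrow> bool" where
  "is_axis lam \<Omega> F e \<longleftrightarrow>
     (\<forall>t. \<forall>x\<in>\<Omega>. x + t *\<^sub>R e \<in> \<Omega> \<longrightarrow> F (x + t *\<^sub>R e) = exp (lam * t) * F x)"

definition A_class :: "real \<Rightarrow> (real^'m) set \<Rightarrow> (real^'m \<Rightarrow> real) set" where
  "A_class lam \<Omega> =
     {F. continuous_on \<Omega> F \<and> smooth_on F (\<Omega> - {x. F x = 0}) \<and> (\<exists>e. is_axis lam \<Omega> F e)}"

definition preimage_region :: "('a \<Rightarrow> real) \<Rightarrow> 'a set \<Rightarrow> real set \<Rightarrow> 'a set" where
  "preimage_region F \<Omega> I = {x \<in> \<Omega>. F x \<in> I}"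

definition level_set :: "('a \<Rightarrow> real) \<Rightarrow> 'a set \<Rightarrow> real \<Rightarrow> 'a set" where
  "level_set F U r = {x \<in> U. F x = r}"


section \<open>Hypersurfaces\<close>

text \<open>Hypersurfaces are embedded, given locally as zero sets of submersions; they may be
  disconnected.\<close>

definition hypersurface :: "(real^'m) set \<Rightarrow> bool" where
  "hypersurface S \<longleftrightarrow>
     (\<forall>p\<in>S. \<exists>U G. open U \<and> p \<in> U \<and> smooth_on (G :: real^'m \<Rightarrow> real) U \<and>
        (\<forall>q\<in>U. frechet_derivative G (at q) \<noteq> (\<lambda>_. 0)) \<and>
        S \<inter> U = {q \<in> U. G q = 0})"

definition tangent_space :: "(real^'m) set \<Rightarrow> real^'m \<Rightarrow> (real^'m) set" where
  "tangent_space S p =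
     {v. \<exists>\<gamma> \<epsilon>. \<epsilon> > 0 \<and> smooth_on \<gamma> {-\<epsilon><..<\<epsilon>} \<and> \<gamma> ` {-\<epsilon><..<\<epsilon>} \<subseteq> S \<and>
        \<gamma> (0::real) = p \<and> (\<gamma> has_vector_derivative v) (at 0)}"

definition smooth_along :: "(real^'m) set \<Rightarrow> (real^'m \<Rightarrow> real^'m) \<Rightarrow> bool" where
  "smooth_along S N \<longleftrightarrow>
     (\<forall>p\<in>S. \<exists>U N'. open U \<and> p \<in> U \<and> smooth_on N' U \<and> (\<forall>q\<in>S \<inter> U. N' q = N q))"

text \<open>\<open>\<partial>\<^sub>X N\<close> for a field \<open>N\<close> along \<open>S\<close> and \<open>X\<close> tangent to \<open>S\<close> at \<open>p\<close>. All derivatives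
  of \<open>N\<close> at \<open>p\<close> within \<open>S\<close> agree on tangent vectors, so the choice made by
  \<^const>\<open>frechet_derivative\<close> is harmless.\<close>

definition deriv_along ::
  "(real^'m) set \<Rightarrow> (real^'m \<Rightarrow> real^'m) \<Rightarrow> real^'m \<Rightarrow> real^'m \<Rightarrow> real^'m" where
  "deriv_along S N p X = frechet_derivative N (at p within S) X"

definition transverse_field :: "(real^'m) set \<Rightarrow> (real^'m \<Rightarrow> real^'m) \<Rightarrow> bool" where
  "transverse_field S N \<longleftrightarrow> smooth_along S N \<and> (\<forall>p\<in>S. N p \<notin> tangent_space S p)"

text \<open>The form \<open>h\<close> in \<open>\<partial>\<^sub>X Y = \<nabla>\<^sub>X Y + h(X,Y) N\<close>: its value at \<open>X, Z\<close> tangent at \<open>p\<close> is the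
  transverse component of \<open>\<partial>\<^sub>X Y\<close> for every local tangent field \<open>Y\<close> with \<open>Y p = Z\<close>.\<close>

definition second_ff ::
  "(real^'m) set \<Rightarrow> (real^'m \<Rightarrow> real^'m) \<Rightarrow> real^'m \<Rightarrow> real^'m \<Rightarrow> real^'m \<Rightarrow> real" where
  "second_ff S N p X Z =
     (THE c. \<forall>U Y. open U \<and> p \<in> U \<and> smooth_along (S \<inter> U) Y \<and>
        (\<forall>q\<in>S \<inter> U. Y q \<in> tangent_space S q) \<and> Y p = Z \<longrightarrow>
        deriv_along (S \<inter> U) Y p X - c *\<^sub>R N p \<in> tangent_space S p)"

text \<open>The form \<open>\<tau>\<^sub>N\<close> in \<open>\<partial>\<^sub>X N = - S(X) + \<tau>\<^sub>N(X) N\<close>.\<close>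

definition connection_form ::
  "(real^'m) set \<Rightarrow> (real^'m \<Rightarrow> real^'m) \<Rightarrow> real^'m \<Rightarrow> real^'m \<Rightarrow> real" where
  "connection_form S N p X =
     (THE c. deriv_along S N p X - c *\<^sub>R N p \<in> tangent_space S p)"

text \<open>Nondegeneracy does not depend on \<open>N\<close>. The existential quantifier makes coorientability
  part of the definition.\<close>

definition nondegenerate_hypersurface :: "(real^'m) set \<Rightarrow> bool" where
  "nondegenerate_hypersurface S \<longleftrightarrow> hypersurface S \<and>
     (\<exists>N. transverse_field S N \<and>
        (\<forall>p\<in>S. \<forall>X\<in>tangent_space S p.
           (\<forall>Y\<in>tangent_space S p. second_ff S N p X Y = 0) \<longrightarrow> X = 0))"


section \<open>Equiaffine normals and improper affine spheres\<close>

text \<open>The ambient space \<open>\<real>\<^sup>n\<^sup>+\<^sup>1\<close> with \<open>n = CARD('n) \<ge> 1\<close> is \<open>real^('n option)\<close>, so that \<open>n\<close>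
  tangent vectors form a family indexed by \<open>'n\<close> and a transverse vector fills the slot \<open>None\<close>.\<close>

definition adjoin :: "real^('n option) \<Rightarrow> (real^('n option))^'n \<Rightarrow> (real^('n option))^('n option)"
  where "adjoin w X = (\<chi> k. case k of None \<Rightarrow> w | Some i \<Rightarrow> X $ i)"

text \<open>The last clause says that the volume density \<open>\<bar>det h(X\<^sub>i,X\<^sub>j)\<bar>\<^sup>1\<^sup>/\<^sup>2\<close> of \<open>h\<close> equals
  the density of the interior product of \<open>W\<close> with \<open>\<Psi>\<close>.\<close>

definition equiaffine_normal ::
  "((real^('n::finite option))^('n option) \<Rightarrow> real) \<Rightarrow> (real^('n option)) set \<Rightarrow>
     (real^('n option) \<Rightarrow> real^('n option)) \<Rightarrow> bool" where
  "equiaffine_normal \<Psi> S W \<longleftrightarrow>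
     transverse_field S W \<and>
     (\<forall>p\<in>S. \<forall>X\<in>tangent_space S p. connection_form S W p X = 0) \<and>
     (\<forall>p\<in>S. \<forall>X :: (real^('n option))^'n. (\<forall>i. X $ i \<in> tangent_space S p) \<longrightarrow>
        sqrt \<bar>det (\<chi> i j. second_ff S W p (X $ i) (X $ j))\<bar> = \<bar>\<Psi> (adjoin (W p) X)\<bar>)"

definition parallel_along :: "(real^'m) set \<Rightarrow> (real^'m \<Rightarrow> real^'m) \<Rightarrow> bool" where
  "parallel_along S W \<longleftrightarrow> (\<exists>v. \<forall>p\<in>S. W p \<in> span {v})"

definition connected_improper_affine_sphere ::
  "((real^('n::finite option))^('n option) \<Rightarrow> real) \<Rightarrow> (real^('n option)) set \<Rightarrow> bool" where
  "connected_improper_affine_sphere \<Psi> S \<longleftrightarrow>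
     connected S \<and> nondegenerate_hypersurface S \<and>
     (\<exists>W. equiaffine_normal \<Psi> S W \<and> parallel_along S W)"

text \<open>Coorientations are represented by transverse fields \<open>V\<close>; two transverse fields are
  consistent iff they point to the same side of each tangent space.\<close>

definition consistent_with ::
  "(real^'m) set \<Rightarrow> (real^'m \<Rightarrow> real^'m) \<Rightarrow> (real^'m \<Rightarrow> real^'m) \<Rightarrow> bool" where
  "consistent_with S V W \<longleftrightarrow> (\<forall>p\<in>S. \<exists>a>0. W p - a *\<^sub>R V p \<in> tangent_space S p)"

definition cooriented_equiaffine_normal ::
  "((real^('n::finite option))^('n option) \<Rightarrow> real) \<Rightarrow> (real^('n option)) set \<Rightarrow>
     (real^('n option) \<Rightarrow> real^('n option)) \<Rightarrow> (real^('n option) \<Rightarrow> real^('n option)) \<Rightarrow> bool" where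
  "cooriented_equiaffine_normal \<Psi> S V W \<longleftrightarrow> equiaffine_normal \<Psi> S W \<and> consistent_with S V W"

text \<open>Number of positive squares minus number of negative squares, for a symmetric bilinear form
  \<open>b\<close> on a subspace \<open>T\<close>.\<close>

definition positive_index :: "('a::euclidean_space \<Rightarrow> 'a \<Rightarrow> real) \<Rightarrow> 'a set \<Rightarrow> nat" where
  "positive_index b T =
     Max {dim U | U. subspace U \<and> U \<subseteq> T \<and> (\<forall>u\<in>U. u \<noteq> 0 \<longrightarrow> b u u > 0)}"

definition signature_on :: "('a::euclidean_space \<Rightarrow> 'a \<Rightarrow> real) \<Rightarrow> 'a set \<Rightarrow> int" where
  "signature_on b T = int (positive_index b T) - int (positive_index (\<lambda>u v. - b u v) T)"

text \<open>A possibly disconnected improper affine sphere with the coorientations of its components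
  given by \<open>V\<close>. An equiaffine normal along \<open>S\<close> is one along each component, as all conditions
  are local; the signature of \<open>h\<close> is constant on each component, so that comparing it at all pairs
  of points compares it on all pairs of components. The empty set is admitted.\<close>

definition cooriented_improper_affine_sphere ::
  "((real^('n::finite option))^('n option) \<Rightarrow> real) \<Rightarrow> (real^('n option)) set \<Rightarrow>
     (real^('n option) \<Rightarrow> real^('n option)) \<Rightarrow> bool" where
  "cooriented_improper_affine_sphere \<Psi> S V \<longleftrightarrow>
     hypersurface S \<and> transverse_field S V \<and>
     (\<forall>C\<in>components S. connected_improper_affine_sphere \<Psi> C) \<and>
     (\<exists>W. cooriented_equiaffine_normal \<Psi> S V W \<and> parallel_along S W \<and>
        (\<forall>p\<in>S. \<forall>q\<in>S.
           signature_on (second_ff S W p) (tangent_space S p) mod 4 =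
           signature_on (second_ff S W q) (tangent_space S q) mod 4))"

definition solves_hess_det_eq ::
  "((real^'m)^'m \<Rightarrow> real) \<Rightarrow> (real^'m \<Rightarrow> real) \<Rightarrow> (real^'m) set \<Rightarrow> real set \<Rightarrow>
     (real \<Rightarrow> real) \<Rightarrow> bool" where
  "solves_hess_det_eq \<Psi> F \<Omega> I \<phi> \<longleftrightarrow>
     (\<forall>r\<in>I. \<phi> r \<noteq> 0) \<and> (\<forall>x\<in>preimage_region F \<Omega> I. hess_det \<Psi> F x = \<phi> (F x))"

end

theory Submission
  imports Defs
begin

text \<open>
Write \<open>U = \<Omega>\<^sub>I\<close>. Differentiating \<open>F(x + t e) = exp(\<lambda> t) F(x)\<close> in \<open>t\<close> gives
\<open>dF(e) = \<lambda> F\<close> and \<open>Hess F(e, X) = \<lambda> dF(X)\<close>. Three consequences carry the proof.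

Since \<open>F\<close> does not vanish on \<open>U\<close>, the axis is transverse to every level set, and it is orthogonal to
the level set with respect to \<open>Hess F\<close>. The Gram matrix of the Hessian on \<open>e, X\<^sub>1, \<dots>, X\<^sub>n\<close> with
tangent \<open>X\<^sub>i\<close> is therefore block diagonal, and
\<open>H(F) \<Psi>(e, X)\<^sup>2 = \<lambda>\<^sup>2 F det Hess F(X\<^sub>i, X\<^sub>j)\<close> (\<open>hess_det_tangential\<close>).

On the level set \<open>F = r\<close> the field \<open>c e\<close> is constant, hence has vanishing connection form, and its
second fundamental form is \<open>- Hess F / (c \<lambda> r)\<close> (\<open>second_ff_level\<close>). Together with the identity
above, the normalization of the equiaffine normal holds for \<open>c e\<close> iff
\<open>\<bar>H(F)\<bar> = \<bar>c \<lambda>\<bar>\<^sup>n\<^sup>+\<^sup>2 \<bar>r\<bar>\<^sup>n\<^sup>+\<^sup>1\<close> (\<open>equiaffine_normal_axis_iff\<close>). So it fixes \<open>H(F)\<close> on the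
level set up to sign.

The sign is what the coorientation and the signature condition control. Where \<open>H(F) \<noteq> 0\<close> one has
\<open>F\<^sup>i = e\<^sup>i / \<lambda>\<close> and \<open>\<bar>dF\<bar>\<^sup>2 = F\<close>, so the prescribed coorientation is the side on which \<open>dF\<close> is negative, and
for a normal on that side \<open>h\<close> is a positive multiple of the Hessian. If \<open>Hess F\<close> has \<open>q\<close> negative
squares on the tangent space, then \<open>h\<close> has signature \<open>n - 2 q\<close>, while the identity above shows that
\<open>H(F)\<close> has the sign of \<open>(-1)\<^sup>q F\<close>. So signatures agree modulo 4 exactly when the signs of \<open>H(F)\<close>
agree (\<open>signature_mod_4_eq_iff\<close>), and for a level set to be an improper affine sphere with this
coorientation and with equiaffine normal \<open>c e\<close> amounts to \<open>H(F)\<close> being a nonzero constant on it.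

Finally \<open>H(F)(x + t e) = exp((n + 1) \<lambda> t) H(F)(x)\<close>, so \<open>\<phi>(r) / r\<^sup>n\<^sup>+\<^sup>1\<close> is locally constant on the set
of values of \<open>F\<close> (\<open>hess_det_power_law\<close>).

The translations also replace the implicit function theorem: a point near a level set slides onto it
along the axis by an explicit smooth map (\<open>slide\<close>), which yields curves in the level set with
prescribed velocity and shows that the components of a level set are relatively open.
\<close>

section \<open>Calculus of smooth maps\<close>

lemma Ck_on_SucD:
  assumes "Ck_on (Suc k) f S"
  shows "x \<in> S \<Longrightarrow> (f has_derivative frechet_derivative f (at x)) (at x)"
    and "Ck_on k (\<lambda>x. frechet_derivative f (at x) v) S"
  using assms by (auto simp: frechet_derivative_works)

lemma Ck_on_cong:
  assumes "open S" "\<And>x. x \<in> S \<Longrightarrow> f x = g x" "Ck_on k f S"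
  shows "Ck_on k g S"
  using assms(2,3)
proof (induction k arbitrary: f g)
  case 0
  then show ?case using continuous_on_cong by fastforce
next
  case (Suc k)
  have d: "(g has_derivative frechet_derivative f (at x)) (at x)" if "x \<in> S" for x
  proof -
    have "(f has_derivative frechet_derivative f (at x)) (at x)"
      using Suc.prems that by (simp add: frechet_derivative_works)
    then show ?thesis
      by (rule has_derivative_transform_within_open[OF _ assms(1) that]) (simp add: Suc.prems)
  qed
  have eq: "frechet_derivative f (at x) v = frechet_derivative g (at x) v" if "x \<in> S" for x v
    using frechet_derivative_at[OF d[OF that]] by simp
  show ?case
    unfolding Ck_on.simps
  proof (intro conjI ballI allI)
    show "g differentiable (at x)" if "x \<in> S" for x
      using d[OF that] by (rule differentiableI)
    show "Ck_on k (\<lambda>x. frechet_derivative g (at x) v) S" for v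
      by (rule Suc.IH[OF eq Ck_on_SucD(2)[OF Suc.prems(2)]])
  qed
qed

lemma Ck_on_subset: "Ck_on k f S \<Longrightarrow> T \<subseteq> S \<Longrightarrow> Ck_on k f T"
  by (induction k arbitrary: f) (auto intro: continuous_on_subset)

lemma Ck_on_const: "Ck_on k (\<lambda>x. c) S"
  by (induction k arbitrary: c) auto

lemma Ck_on_ident: "Ck_on k (\<lambda>x. x) S"
  by (cases k) (auto simp: Ck_on_const)

lemma Ck_on_Suc_imp_Ck_on: "Ck_on (Suc k) f S \<Longrightarrow> Ck_on k f S"
proof (induction k arbitrary: f)
  case 0
  then show ?case
    by (auto intro!: continuous_at_imp_continuous_on differentiable_imp_continuous_within)
next
  case (Suc k)
  show ?case
    unfolding Ck_on.simps(2)[of k]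
    using Suc.prems Suc.IH by (metis Ck_on.simps(2))
qed

text \<open>A map with prescribed derivative \<open>f'\<close> is of class \<open>k + 1\<close> once all the \<open>f' \<cdot> v\<close> are of
  class \<open>k\<close>; this spares the bookkeeping with the canonical choice of derivative.\<close>

lemma Ck_on_SucI:
  assumes "open S" "\<And>x. x \<in> S \<Longrightarrow> (f has_derivative f' x) (at x)"
    and "\<And>v. Ck_on k (\<lambda>x. f' x v) S"
  shows "Ck_on (Suc k) f S"
proof -
  have "Ck_on k (\<lambda>x. frechet_derivative f (at x) v) S" for v
    by (rule Ck_on_cong[OF assms(1) _ assms(3)]) (rule fun_cong[OF frechet_derivative_at[OF assms(2)]])
  then show ?thesis
    using assms(2) by (auto simp: differentiable_def)
qed

lemma Ck_on_bounded_linear: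
  assumes "bounded_linear L" "open S" "Ck_on k f S"
  shows "Ck_on k (\<lambda>x. L (f x)) S"
  using assms(3)
proof (induction k arbitrary: f)
  case 0
  then show ?case
    using bounded_linear.continuous_on[OF assms(1)] by auto
next
  case (Suc k)
  show ?case
    by (rule Ck_on_SucI[OF assms(2), where f' = "\<lambda>x v. L (frechet_derivative f (at x) v)"])
      (use Suc.IH Ck_on_SucD[OF Suc.prems] in
        \<open>auto intro: bounded_linear.has_derivative[OF assms(1)]\<close>)
qed

lemma Ck_on_add:
  assumes "open S" "Ck_on k f S" "Ck_on k g S"
  shows "Ck_on k (\<lambda>x. f x + g x) S"
  using assms(2,3)
proof (induction k arbitrary: f g)
  case 0
  then show ?case by (auto intro: continuous_on_add)
next
  case (Suc k)
  show ?case
    by (rule Ck_on_SucI[OF assms(1), where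
          f' = "\<lambda>x v. frechet_derivative f (at x) v + frechet_derivative g (at x) v"])
      (use Suc.IH Ck_on_SucD[OF Suc.prems(1)] Ck_on_SucD[OF Suc.prems(2)] in
        \<open>auto intro: has_derivative_add\<close>)
qed

lemma Ck_on_diff:
  assumes "open S" "Ck_on k f S" "Ck_on k g S"
  shows "Ck_on k (\<lambda>x. f x - g x) S"
  using Ck_on_add[OF assms(1,2) Ck_on_bounded_linear[OF bounded_linear_minus[OF bounded_linear_ident] assms(1,3)]]
  by simp

lemma Ck_on_mult:
  fixes f g :: "'a::real_normed_vector \<Rightarrow> real"
  assumes "open S" "Ck_on k f S" "Ck_on k g S"
  shows "Ck_on k (\<lambda>x. f x * g x) S"
  using assms(2,3)
proof (induction k arbitrary: f g)
  case 0
  then show ?case by (auto intro: continuous_on_mult)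
next
  case (Suc k)
  note D = Ck_on_SucD[OF Suc.prems(1)] Ck_on_SucD[OF Suc.prems(2)]
  show ?case
    by (rule Ck_on_SucI[OF assms(1), where
          f' = "\<lambda>x v. f x * frechet_derivative g (at x) v + frechet_derivative f (at x) v * g x"])
      (use D Suc.IH Suc.prems[THEN Ck_on_Suc_imp_Ck_on] in
        \<open>auto intro!: has_derivative_mult Ck_on_add[OF assms(1)]\<close>)
qed

lemma Ck_on_inverse:
  fixes f :: "'a::real_normed_vector \<Rightarrow> real"
  assumes "open S" "\<And>x. x \<in> S \<Longrightarrow> f x \<noteq> 0" "Ck_on k f S"
  shows "Ck_on k (\<lambda>x. inverse (f x)) S"
  using assms(3)
proof (induction k)
  case 0
  then show ?case using assms(2) by (auto intro: continuous_on_inverse)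
next
  case (Suc k)
  have i: "Ck_on k (\<lambda>x. inverse (f x)) S"
    by (rule Suc.IH[OF Ck_on_Suc_imp_Ck_on[OF Suc.prems]])
  have m: "Ck_on k (\<lambda>x. - (inverse (f x) * frechet_derivative f (at x) v * inverse (f x))) S" for v
    by (intro Ck_on_bounded_linear[OF bounded_linear_minus[OF bounded_linear_ident] assms(1)]
        Ck_on_mult i Ck_on_SucD[OF Suc.prems] assms(1))
  show ?case
  proof (rule Ck_on_SucI[OF assms(1) _ m])
    fix x assume x: "x \<in> S"
    show "((\<lambda>x. inverse (f x)) has_derivative
        (\<lambda>v. - (inverse (f x) * frechet_derivative f (at x) v * inverse (f x)))) (at x)"
      by (rule Deriv.has_derivative_inverse[OF assms(2)[OF x] Ck_on_SucD(1)[OF Suc.prems x]])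
  qed
qed

lemma Ck_on_ln:
  fixes f :: "'a::real_normed_vector \<Rightarrow> real"
  assumes "open S" "\<And>x. x \<in> S \<Longrightarrow> f x > 0" "Ck_on k f S"
  shows "Ck_on k (\<lambda>x. ln (f x)) S"
proof (cases k)
  case 0
  have "f x \<noteq> 0" if "x \<in> S" for x using assms(2)[OF that] by simp
  then show ?thesis using 0 assms by (auto intro!: continuous_on_ln)
next
  case (Suc j)
  note D = Ck_on_SucD[OF assms(3)[unfolded Suc]]
  have nz: "f x \<noteq> 0" if "x \<in> S" for x using assms(2)[OF that] by simp
  have m: "Ck_on j (\<lambda>x. frechet_derivative f (at x) v * inverse (f x)) S" for v
    by (intro Ck_on_mult Ck_on_inverse nz assms(1) D
          Ck_on_Suc_imp_Ck_on[OF assms(3)[unfolded Suc]])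
  show ?thesis
    unfolding Suc
  proof (rule Ck_on_SucI[OF assms(1) _ m])
    fix x assume x: "x \<in> S"
    show "((\<lambda>x. ln (f x)) has_derivative (\<lambda>v. frechet_derivative f (at x) v * inverse (f x))) (at x)"
      using has_derivative_ln[OF assms(2)[OF x] D(1)[OF x]] by simp
  qed
qed

lemma Ck_on_line:
  fixes f :: "'a::real_normed_vector \<Rightarrow> 'b::real_normed_vector"
  assumes "open S" "open T" "\<And>t. t \<in> T \<Longrightarrow> p + t *\<^sub>R v \<in> S" "Ck_on k f S"
  shows "Ck_on k (\<lambda>t. f (p + t *\<^sub>R v)) T"
  using assms(4)
proof (induction k arbitrary: f)
  case 0
  then show ?case
    using assms(3) by (auto intro!: continuous_on_compose2[of S f] continuous_intros)
next
  case (Suc k)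
  have c: "Ck_on k (\<lambda>t. h *\<^sub>R frechet_derivative f (at (p + t *\<^sub>R v)) v) T" for h
    by (intro Ck_on_bounded_linear[OF bounded_linear_scaleR_right assms(2)] Suc.IH
        Ck_on_SucD[OF Suc.prems])
  show ?case
  proof (rule Ck_on_SucI[OF assms(2) _ c])
    fix t assume t: "t \<in> T"
    have "((\<lambda>t. p + t *\<^sub>R v) has_derivative (\<lambda>h. h *\<^sub>R v)) (at t)"
      by (auto intro!: derivative_eq_intros)
    from has_derivative_compose[OF this Ck_on_SucD(1)[OF Suc.prems assms(3)[OF t]]]
    show "((\<lambda>t. f (p + t *\<^sub>R v)) has_derivative
        (\<lambda>h. h *\<^sub>R frechet_derivative f (at (p + t *\<^sub>R v)) v)) (at t)"
      using linear_frechet_derivative[of f "at (p + t *\<^sub>R v)"] Suc.prems assms(3)[OF t]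
      by (simp add: linear_cmul)
  qed
qed


subsection \<open>Symmetry of the Hessian\<close>

text \<open>The second difference quotient of \<open>F\<close> in the directions \<open>u\<close> and \<open>v\<close> is, by the mean value
  theorem used twice, a value of the mixed second derivative at a nearby point; it is symmetric
  in \<open>u\<close> and \<open>v\<close>.\<close>

lemma second_difference_mean_value:
  fixes F :: "real^'m \<Rightarrow> real"
  assumes F: "Ck_on 2 F U" and h: "h > 0"
    and box: "\<And>s t. 0 \<le> s \<Longrightarrow> s \<le> h \<Longrightarrow> 0 \<le> t \<Longrightarrow> t \<le> h \<Longrightarrow> x + s *\<^sub>R u + t *\<^sub>R v \<in> U"
  shows "\<exists>s t. 0 < s \<and> s < h \<and> 0 < t \<and> t < h \<and>
    F (x + h *\<^sub>R u + h *\<^sub>R v) - F (x + h *\<^sub>R u) - F (x + h *\<^sub>R v) + F x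
      = h * h * hess F (x + s *\<^sub>R u + t *\<^sub>R v) v u"
proof -
  have F': "Ck_on (Suc (Suc 0)) F U" using F by (simp add: numeral_2_eq_2)
  note D1 = Ck_on_SucD[OF F'] and D2 = Ck_on_SucD(1)[OF Ck_on_SucD(2)[OF F', of u]]
  define g where "g s = F (x + s *\<^sub>R u + h *\<^sub>R v) - F (x + s *\<^sub>R u + 0 *\<^sub>R v)" for s
  have dline: "((\<lambda>s. F (x + s *\<^sub>R u + t *\<^sub>R v)) has_field_derivative
      frechet_derivative F (at (x + s *\<^sub>R u + t *\<^sub>R v)) u) (at s)"
    if "0 \<le> s" "s \<le> h" "0 \<le> t" "t \<le> h" for s t
  proof -
    have "((\<lambda>s. x + s *\<^sub>R u + t *\<^sub>R v) has_derivative (\<lambda>h. h *\<^sub>R u)) (at s)"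
      by (auto intro!: derivative_eq_intros)
    from has_derivative_compose[OF this D1(1)[OF box[OF that]]]
    show ?thesis
      using linear_frechet_derivative[of F "at (x + s *\<^sub>R u + t *\<^sub>R v)"] F' box[OF that]
      by (simp add: linear_cmul has_field_derivative_def mult_commute_abs)
  qed
  have dline2: "((\<lambda>t. frechet_derivative F (at (x + s *\<^sub>R u + t *\<^sub>R v)) u) has_field_derivative
      hess F (x + s *\<^sub>R u + t *\<^sub>R v) v u) (at t)"
    if "0 \<le> s" "s \<le> h" "0 \<le> t" "t \<le> h" for s t
  proof -
    have "((\<lambda>t. x + s *\<^sub>R u + t *\<^sub>R v) has_derivative (\<lambda>h. h *\<^sub>R v)) (at t)"
      by (auto intro!: derivative_eq_intros)
    from has_derivative_compose[OF this D2[OF box[OF that]]]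
    show ?thesis
      using linear_frechet_derivative[of "\<lambda>y. frechet_derivative F (at y) u" "at (x + s *\<^sub>R u + t *\<^sub>R v)"]
        Ck_on_SucD(2)[OF F', of u] box[OF that]
      by (simp add: linear_cmul has_field_derivative_def mult_commute_abs hess_def)
  qed
  have gd: "(g has_field_derivative frechet_derivative F (at (x + s *\<^sub>R u + h *\<^sub>R v)) u
     - frechet_derivative F (at (x + s *\<^sub>R u + 0 *\<^sub>R v)) u) (at s)"
    if "0 \<le> s" "s \<le> h" for s
    unfolding g_def by (intro DERIV_diff dline) (use that h in auto)
  obtain s where s: "0 < s" "s < h" "g h - g 0 = (h - 0) *
      (frechet_derivative F (at (x + s *\<^sub>R u + h *\<^sub>R v)) u
     - frechet_derivative F (at (x + s *\<^sub>R u + 0 *\<^sub>R v)) u)"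
    using MVT2[OF h gd] by auto
  obtain t where t: "0 < t" "t < h" "frechet_derivative F (at (x + s *\<^sub>R u + h *\<^sub>R v)) u
     - frechet_derivative F (at (x + s *\<^sub>R u + 0 *\<^sub>R v)) u
      = (h - 0) * hess F (x + s *\<^sub>R u + t *\<^sub>R v) v u"
    using MVT2[OF h dline2[of s]] s by auto
  show ?thesis
    using s t by (intro exI[of _ s] exI[of _ t]) (auto simp: g_def)
qed

lemma hess_sym:
  fixes F :: "real^'m \<Rightarrow> real"
  assumes "open U" "Ck_on 2 F U" "x \<in> U"
  shows "hess F x u v = hess F x v u"
proof (rule ccontr)
  assume ne: "hess F x u v \<noteq> hess F x v u"
  define d where "d = \<bar>hess F x u v - hess F x v u\<bar> / 2"
  have d: "d > 0" using ne by (simp add: d_def)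
  have c: "continuous_on U (\<lambda>y. hess F y a b)" for a b
    using assms(2) by (simp add: numeral_2_eq_2 hess_def)
  have near: "\<exists>r>0. ball x r \<subseteq> U \<and> (\<forall>y\<in>ball x r. \<bar>hess F y a b - hess F x a b\<bar> < d)" for a b
  proof -
    obtain r1 where r1: "r1 > 0" "ball x r1 \<subseteq> U"
      using assms(1,3) openE by blast
    obtain r2 where r2: "r2 > 0" "\<And>y. y \<in> U \<Longrightarrow> dist y x < r2 \<Longrightarrow> dist (hess F y a b) (hess F x a b) < d"
      using c[unfolded continuous_on_iff] assms(3) d by metis
    show ?thesis
    proof (intro exI[of _ "min r1 r2"] conjI ballI)
      fix y assume "y \<in> ball x (min r1 r2)"
      then have "y \<in> U" "dist y x < r2" using r1 by (auto simp: dist_commute)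
      then show "\<bar>hess F y a b - hess F x a b\<bar> < d" using r2 by (simp add: dist_real_def)
    qed (use r1 r2 in auto)
  qed
  obtain r1 where r1: "r1 > 0" "ball x r1 \<subseteq> U" "\<And>y. y \<in> ball x r1 \<Longrightarrow> \<bar>hess F y u v - hess F x u v\<bar> < d"
    using near[of u v] by blast
  obtain r2 where r2: "r2 > 0" "\<And>y. y \<in> ball x r2 \<Longrightarrow> \<bar>hess F y v u - hess F x v u\<bar> < d"
    using near[of v u] by blast
  define r where "r = min r1 r2"
  \<comment> \<open>The side length \<open>h\<close> keeps the parallelogram spanned by \<open>h u\<close> and \<open>h v\<close> at \<open>x\<close> inside the ball
    where both mixed derivatives are within \<open>d\<close> of their values at \<open>x\<close>.\<close>
  define M where "M = norm u + norm v + 1"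
  define h where "h = r / (2 * M)"
  have r: "r > 0" using r1 r2 by (simp add: r_def)
  have npos: "M > 0" unfolding M_def by (smt (verit) norm_ge_zero)
  have h: "h > 0" using r npos by (simp add: h_def)
  have inb: "x + s *\<^sub>R a + t *\<^sub>R b \<in> ball x r"
    if "0 \<le> s" "s \<le> h" "0 \<le> t" "t \<le> h" "norm a + norm b = norm u + norm v" for s t a b
  proof -
    have "norm (s *\<^sub>R a + t *\<^sub>R b) \<le> s * norm a + t * norm b"
      using norm_triangle_ineq[of "s *\<^sub>R a" "t *\<^sub>R b"] that by simp
    also have "\<dots> \<le> h * norm a + h * norm b"
      using that by (intro add_mono mult_right_mono) auto
    also have "\<dots> = h * (norm u + norm v)" using that by (simp add: distrib_left[symmetric])
    also have "\<dots> \<le> h * M" using h by (simp add: M_def)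
    also have "\<dots> = r / 2" using npos by (simp add: h_def)
    also have "\<dots> < r" using r by simp
    finally show ?thesis
      using norm_minus_cancel[of "s *\<^sub>R a + t *\<^sub>R b"] by (simp add: dist_norm)
  qed
  have sub: "ball x r \<subseteq> U" using r1 by (auto simp: r_def)
  have C2: "Ck_on 2 F (ball x r)" by (rule Ck_on_subset[OF assms(2) sub])
  obtain s t where st: "0 < s" "s < h" "0 < t" "t < h"
    "F (x + h *\<^sub>R u + h *\<^sub>R v) - F (x + h *\<^sub>R u) - F (x + h *\<^sub>R v) + F x
      = h * h * hess F (x + s *\<^sub>R u + t *\<^sub>R v) v u"
    using second_difference_mean_value[OF C2 h, of x u v] inb[of _ _ u v] by auto
  obtain s' t' where st': "0 < s'" "s' < h" "0 < t'" "t' < h"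
    "F (x + h *\<^sub>R v + h *\<^sub>R u) - F (x + h *\<^sub>R v) - F (x + h *\<^sub>R u) + F x
      = h * h * hess F (x + s' *\<^sub>R v + t' *\<^sub>R u) u v"
    using second_difference_mean_value[OF C2 h, of x v u] inb[of _ _ v u] by auto
  have "h * h * hess F (x + s *\<^sub>R u + t *\<^sub>R v) v u = h * h * hess F (x + s' *\<^sub>R v + t' *\<^sub>R u) u v"
    using st(5) st'(5) by (simp add: algebra_simps)
  then have eq: "hess F (x + s *\<^sub>R u + t *\<^sub>R v) v u = hess F (x + s' *\<^sub>R v + t' *\<^sub>R u) u v"
    using h by simp
  have "\<bar>hess F (x + s *\<^sub>R u + t *\<^sub>R v) v u - hess F x v u\<bar> < d"
    using inb[of s t u v] st by (intro r2) (auto simp: r_def)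
  moreover have "\<bar>hess F (x + s' *\<^sub>R v + t' *\<^sub>R u) u v - hess F x u v\<bar> < d"
    using inb[of s' t' v u] st' by (intro r1) (auto simp: r_def add.commute)
  ultimately show False using eq unfolding d_def by (smt (verit) field_sum_of_halves)
qed


section \<open>Alternating forms and determinants\<close>

text \<open>Every matrix is a product of matrices that are diagonal, have a zero row, or perform an
  elementary row operation. Multiplication by each of these from the left changes an alternating form
  of the rows by the factor by which it changes the determinant.\<close>

lemma alternating_form_eq_det:
  fixes \<Psi> :: "real^'m^'m \<Rightarrow> real"
  assumes lin: "\<And>v i. linear (\<lambda>x. \<Psi> (\<chi> j. if j = i then x else v $ j))"
    and alt: "\<And>v i j. i \<noteq> j \<Longrightarrow> v $ i = v $ j \<Longrightarrow> \<Psi> v = 0"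
  shows "\<Psi> v = det v * \<Psi> (mat 1)"
proof -
  define upd :: "real^'m^'m \<Rightarrow> 'm \<Rightarrow> real^'m \<Rightarrow> real^'m^'m"
    where "upd v i x = (\<chi> j. if j = i then x else v $ j)" for v i x
  have upd_self: "upd v i (v $ i) = v" for v i
    by (simp add: upd_def vec_eq_iff)
  have upd_add: "\<Psi> (upd v i (x + y)) = \<Psi> (upd v i x) + \<Psi> (upd v i y)" for v i x y
    unfolding upd_def by (rule linear_add[OF lin])
  have upd_scale: "\<Psi> (upd v i (c *\<^sub>R x)) = c * \<Psi> (upd v i x)" for v i x c
    using linear_cmul[OF lin[of i v]] by (simp add: upd_def)
  have upd_same: "\<Psi> (upd v i (v $ j)) = 0" if "i \<noteq> j" for v i j
    by (rule alt[OF that]) (use that in \<open>simp add: upd_def\<close>)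
  have swap: "\<Psi> (\<chi> i. v $ Transposition.transpose m n i) = - \<Psi> v" if "m \<noteq> n" for v m n
  proof -
    define w where "w x y = upd (upd v m x) n y" for x y
    have w_add1: "\<Psi> (w (x + x') y) = \<Psi> (w x y) + \<Psi> (w x' y)" for x x' y
    proof -
      have "w x y = upd (upd v n y) m x" for x using that by (auto simp: w_def upd_def vec_eq_iff)
      then show ?thesis by (simp add: upd_add)
    qed
    have w_add2: "\<Psi> (w x (y + y')) = \<Psi> (w x y) + \<Psi> (w x y')" for x y y'
      by (simp add: w_def upd_add)
    have w_same: "\<Psi> (w x x) = 0" for x
      by (rule alt[OF that]) (use that in \<open>simp add: w_def upd_def\<close>)
    have "\<Psi> (w (v $ m) (v $ n)) + \<Psi> (w (v $ n) (v $ m)) = 0"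
      using w_same[of "v $ m + v $ n"] unfolding w_add1 w_add2 by (simp add: w_same)
    moreover have "w (v $ m) (v $ n) = v" by (simp add: w_def upd_def vec_eq_iff)
    moreover have "w (v $ n) (v $ m) = (\<chi> i. v $ Transposition.transpose m n i)"
      by (auto simp: w_def upd_def vec_eq_iff Transposition.transpose_def)
    ultimately show ?thesis by simp
  qed
  have rows: "(A ** V) $ i = (\<Sum>k\<in>UNIV. A $ i $ k *\<^sub>R V $ k)" for A V :: "real^'m^'m" and i
    by (simp add: matrix_matrix_mult_def vec_eq_iff)
  have main: "\<forall>V. \<Psi> (A ** V) = det A * \<Psi> V" for A
  proof (induction A rule: induct_matrix_elementary[case_names mult zero_row diagonal swap1 idplus])
    case (mult A B)
    then show ?case by (simp add: det_mul matrix_mul_assoc[symmetric])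
  next
    case (zero_row A i)
    show ?case
    proof
      fix V :: "real^'m^'m"
      have "A $ i = 0" using zero_row by (simp add: row_def vec_eq_iff)
      then have "(A ** V) $ i = 0 *\<^sub>R 0" by (simp add: rows)
      then have "\<Psi> (A ** V) = 0"
        using upd_scale[of "A ** V" i 0 0] upd_self[of "A ** V" i] by simp
      then show "\<Psi> (A ** V) = det A * \<Psi> V" by (simp add: det_zero_row(2)[OF zero_row])
    qed
  next
    case (diagonal A)
    show ?case
    proof
      fix V :: "real^'m^'m"
      have "\<Psi> (\<chi> i. if i \<in> S then A $ i $ i *\<^sub>R V $ i else V $ i) = (\<Prod>i\<in>S. A $ i $ i) * \<Psi> V" for S
      proof (induction S rule: infinite_finite_induct)
        case (insert k S)
        define v' where "v' = (\<chi> i. if i \<in> S then A $ i $ i *\<^sub>R V $ i else V $ i)"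
        have "(\<chi> i. if i \<in> insert k S then A $ i $ i *\<^sub>R V $ i else V $ i)
            = upd v' k (A $ k $ k *\<^sub>R v' $ k)"
          using insert.hyps by (auto simp: v'_def upd_def vec_eq_iff)
        then show ?case
          using insert by (simp add: upd_scale upd_self v'_def[symmetric])
      qed auto
      from this[of UNIV]
      have "\<Psi> (\<chi> i. A $ i $ i *\<^sub>R V $ i) = det A * \<Psi> V" by (simp add: det_diagonal diagonal)
      moreover have "(A ** V) = (\<chi> i. A $ i $ i *\<^sub>R V $ i)"
      proof -
        have "(\<Sum>k\<in>UNIV. A $ i $ k *\<^sub>R V $ k) = (\<Sum>k\<in>UNIV. if k = i then A $ i $ i *\<^sub>R V $ i else 0)" for i
          by (rule sum.cong) (auto simp: diagonal)
        then show ?thesis by (subst vec_eq_iff) (simp add: rows)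
      qed
      ultimately show "\<Psi> (A ** V) = det A * \<Psi> V" by simp
    qed
  next
    case (swap1 m n)
    let ?E = "(\<chi> i j. mat 1 $ i $ Transposition.transpose m n j) :: real^'m^'m"
    have "det ?E = -1"
      using swap1 det_permute_columns[of "Transposition.transpose m n" "mat 1 :: real^'m^'m"]
      by (simp add: permutes_swap_id sign_swap_id)
    moreover have "?E ** V = (\<chi> i. V $ Transposition.transpose m n i)" for V :: "real^'m^'m"
    proof -
      have "(\<Sum>k\<in>UNIV. ?E $ i $ k *\<^sub>R V $ k)
          = (\<Sum>k\<in>UNIV. if k = Transposition.transpose m n i then V $ k else 0)" for i
        by (rule sum.cong) (auto simp: mat_def Transposition.transpose_def)
      then show ?thesis by (subst vec_eq_iff) (simp add: rows)
    qed
    ultimately show ?case by (simp add: swap[OF swap1])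
  next
    case (idplus m n c)
    let ?E = "(\<chi> i j. if i = m \<and> j = n then c else of_bool (i = j)) :: real^'m^'m"
    have "?E = (\<chi> k. if k = m then row m (mat 1) + c *s row n (mat 1) else row k (mat 1))"
      using idplus by (auto simp: vec_eq_iff row_def mat_def)
    then have "det ?E = 1" by (simp add: det_row_operation[OF idplus])
    moreover have "\<Psi> (?E ** V) = \<Psi> V" for V :: "real^'m^'m"
    proof -
      have "(\<Sum>k\<in>UNIV. ?E $ i $ k *\<^sub>R V $ k)
          = (\<Sum>k\<in>UNIV. (if k = i then V $ k else 0) + (if k = n then (if i = m then c *\<^sub>R V $ k else 0) else 0))" for i
        by (rule sum.cong) (use idplus in auto)
      then have "?E ** V = upd V m (V $ m + c *\<^sub>R V $ n)"
        by (subst vec_eq_iff) (auto simp: rows sum.distrib upd_def)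
      then show ?thesis by (simp add: upd_add upd_scale upd_self upd_same[OF idplus])
    qed
    ultimately show ?case by simp
  qed
  from main[of v] show ?thesis
    by (metis matrix_mul_rid)
qed

text \<open>As a function of the rows of \<open>B\<close>, the determinant of the block matrix is itself an
  alternating form, so that only the case of the identity matrix has to be computed.\<close>

lemma det_option_block:
  fixes B :: "real^('n::finite)^'n"
  shows "det (\<chi> k l. case k of None \<Rightarrow> (case l of None \<Rightarrow> a | Some j \<Rightarrow> 0)
      | Some i \<Rightarrow> (case l of None \<Rightarrow> 0 | Some j \<Rightarrow> B $ i $ j) :: real^('n option)^('n option))
    = a * det B"
proof -
  define emb :: "real^'n \<Rightarrow> real^('n option)"
    where "emb x = (\<chi> l. case l of None \<Rightarrow> 0 | Some j \<Rightarrow> x $ j)" for x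
  define bl :: "real^'n^'n \<Rightarrow> real^('n option)^('n option)"
    where "bl B = (\<chi> k. case k of None \<Rightarrow> axis None a | Some i \<Rightarrow> emb (B $ i))" for B
  have upd: "bl (\<chi> j. if j = i then x else v $ j) = (\<chi> k. if k = Some i then emb x else bl v $ k)"
    for i x v by (auto simp: bl_def vec_eq_iff split: option.split)
  have "det (bl B) = det B * det (bl (mat 1))"
  proof (rule alternating_form_eq_det)
    fix v :: "real^'n^'n" and i
    show "linear (\<lambda>x. det (bl (\<chi> j. if j = i then x else v $ j)))"
    proof (rule linearI)
      fix x y :: "real^'n" and c :: real
      have emb: "emb (x + y) = emb x + emb y" "emb (c *\<^sub>R x) = c *s emb x"
        by (auto simp: emb_def vec_eq_iff split: option.split)
      show "det (bl (\<chi> j. if j = i then x + y else v $ j)) =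
          det (bl (\<chi> j. if j = i then x else v $ j)) + det (bl (\<chi> j. if j = i then y else v $ j))"
        "det (bl (\<chi> j. if j = i then c *\<^sub>R x else v $ j)) =
          c *\<^sub>R det (bl (\<chi> j. if j = i then x else v $ j))"
        unfolding upd emb
        using det_row_add[of "Some i" "\<lambda>_. emb x" "\<lambda>_. emb y" "($) (bl v)"]
          det_row_mul[of "Some i" c "\<lambda>_. emb x" "($) (bl v)"] by simp_all
    qed
  next
    fix v :: "real^'n^'n" and i j :: 'n
    assume "i \<noteq> j" "v $ i = v $ j"
    then show "det (bl v) = 0"
      by (intro det_identical_rows[of "Some i" "Some j"]) (auto simp: row_def bl_def)
  qed
  moreover have "det (bl (mat 1)) = a"
  proof -
    have "det (bl (mat 1)) = (\<Prod>k\<in>UNIV. bl (mat 1) $ k $ k)"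
      by (rule det_diagonal) (auto simp: bl_def emb_def mat_def axis_def split: option.split)
    also have "\<dots> = a"
      by (simp add: UNIV_option_conv prod.reindex bl_def emb_def mat_def)
    finally show ?thesis .
  qed
  moreover have "bl B = (\<chi> k l. case k of None \<Rightarrow> (case l of None \<Rightarrow> a | Some j \<Rightarrow> 0)
      | Some i \<Rightarrow> (case l of None \<Rightarrow> 0 | Some j \<Rightarrow> B $ i $ j))"
    by (auto simp: bl_def emb_def axis_def vec_eq_iff split: option.split)
  ultimately show ?thesis by simp
qed


section \<open>Symmetric bilinear forms\<close>

text \<open>A vector \<open>u\<close> with \<open>b u u \<noteq> 0\<close> splits off, its orthogonal complement in \<open>T\<close> having smaller
  dimension.\<close>

lemma orthogonal_basis_exists:
  fixes b :: "'a::euclidean_space \<Rightarrow> 'a \<Rightarrow> real"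
  assumes b: "bilinear b" "\<And>x y. b x y = b y x" and "subspace T"
  shows "\<exists>B. B \<subseteq> T \<and> independent B \<and> span B = T \<and> pairwise (\<lambda>x y. b x y = 0) B"
  using \<open>subspace T\<close>
proof (induction "dim T" arbitrary: T rule: less_induct)
  case less
  note bs = bilinear_ladd[OF b(1)] bilinear_radd[OF b(1)] bilinear_lmul[OF b(1)]
    bilinear_rmul[OF b(1)] bilinear_lsub[OF b(1)] bilinear_rsub[OF b(1)]
  show ?case
  proof (cases "\<exists>u\<in>T. b u u \<noteq> 0")
    case True
    then obtain u where u: "u \<in> T" "b u u \<noteq> 0" by blast
    define T' where "T' = {x \<in> T. b x u = 0}"
    have sub': "subspace T'"
      using less.prems bilinear_lzero[OF b(1)]
      by (auto simp: T'_def subspace_def bs)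
    have "T' \<subset> T" using u by (auto simp: T'_def)
    then have "dim T' < dim T"
      by (metis dim_psubset less.prems span_eq_iff sub')
    from less.hyps[OF this sub'] obtain B where B: "B \<subseteq> T'" "independent B" "span B = T'"
      "pairwise (\<lambda>x y. b x y = 0) B" by blast
    have "u \<notin> span B" using u by (simp add: B T'_def)
    then have "independent (insert u B)" using B by (simp add: independent_insert span_base)
    moreover have sB: "insert u B \<subseteq> T" using u B by (auto simp: T'_def)
    moreover have "T \<subseteq> span (insert u B)"
    proof
      fix x assume x: "x \<in> T"
      have "x - (b x u / b u u) *\<^sub>R u \<in> span B"
        unfolding B(3) T'_def using u x less.prems by (simp add: bs subspace_diff subspace_mul)
      then show "x \<in> span (insert u B)" by (auto simp: span_insert)
    qed
    moreover have "span (insert u B) \<subseteq> T"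
      using sB less.prems by (simp add: span_minimal)
    moreover have "pairwise (\<lambda>x y. b x y = 0) (insert u B)"
      using B b(2) by (auto simp: pairwise_insert T'_def)
    ultimately show ?thesis by blast
  next
    \<comment> \<open>By polarization the form vanishes identically on \<open>T\<close>, and every basis will do.\<close>
    case False
    have z: "b x y = 0" if "x \<in> T" "y \<in> T" for x y
    proof -
      have "b (x + y) (x + y) = 0" "b x x = 0" "b y y = 0"
        using False that less.prems by (auto simp: subspace_add)
      then show ?thesis using b(2)[of x y] by (simp add: bs)
    qed
    obtain B where "B \<subseteq> T" "independent B" "T \<subseteq> span B" using basis_exists[of T] by metis
    then show ?thesis
      using z span_minimal[OF _ less.prems, of B] by (intro exI[of _ B]) (auto simp: pairwise_def)
  qed
qed

lemma definite_on_span: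
  fixes b :: "'a::euclidean_space \<Rightarrow> 'a \<Rightarrow> real"
  assumes b: "bilinear b" and B: "independent P" "pairwise (\<lambda>x y. b x y = 0) P"
    and pos: "\<And>x. x \<in> P \<Longrightarrow> b x x > 0" and u: "u \<in> span P" "u \<noteq> 0"
  shows "b u u > 0"
proof -
  have fin: "finite P" using B by (simp add: independent_imp_finite)
  obtain c where c: "u = (\<Sum>x\<in>P. c x *\<^sub>R x)"
    using u(1) by (auto simp: span_finite[OF fin])
  have "b u u = (\<Sum>x\<in>P. \<Sum>y\<in>P. c x * c y * b x y)"
    by (simp add: c bilinear_sum[OF b] sum.cartesian_product bilinear_lmul[OF b] bilinear_rmul[OF b])
      (auto intro!: sum.cong)
  also have "\<dots> = (\<Sum>x\<in>P. \<Sum>y\<in>P. if y = x then c x * c x * b x x else 0)"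
    using B(2) by (intro sum.cong refl) (auto simp: pairwise_def)
  also have "\<dots> = (\<Sum>x\<in>P. (c x)\<^sup>2 * b x x)"
    using fin by (simp add: power2_eq_square)
  also have "\<dots> > 0"
  proof -
    obtain x where x: "x \<in> P" "c x \<noteq> 0"
    proof -
      have "\<not> (\<forall>x\<in>P. c x = 0)"
      proof
        assume "\<forall>x\<in>P. c x = 0"
        then have "u = 0" unfolding c by (intro sum.neutral) simp
        then show False using u(2) by simp
      qed
      then show ?thesis using that by blast
    qed
    show ?thesis
      by (rule sum_pos2[OF fin x(1)]) (use x pos in \<open>auto simp: less_imp_le\<close>)
  qed
  finally show ?thesis .
qed

text \<open>A positive definite subspace meets the span of the negative basis vectors trivially,
  which bounds its dimension (Sylvester's law of inertia).\<close>

lemma positive_index_orthogonal_basis: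
  fixes b :: "'a::euclidean_space \<Rightarrow> 'a \<Rightarrow> real"
  assumes b: "bilinear b" and B: "independent B" "span B = T" "pairwise (\<lambda>x y. b x y = 0) B"
    and nz: "\<And>x. x \<in> B \<Longrightarrow> b x x \<noteq> 0"
  shows "positive_index b T = card {x \<in> B. b x x > 0}"
proof -
  let ?P = "{x \<in> B. b x x > 0}" and ?N = "{x \<in> B. b x x < 0}"
  have fin: "finite B" using B by (simp add: independent_imp_finite)
  have PN: "?P \<union> ?N = B" "?P \<inter> ?N = {}" using nz by fastforce+
  have ind: "independent ?P" "independent ?N"
    by (rule independent_mono[OF B(1)]; auto)+
  have pw: "pairwise (\<lambda>x y. b x y = 0) ?P" "pairwise (\<lambda>x y. - b x y = 0) ?N"
    using B(3) by (auto simp: pairwise_def)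
  have mb: "bilinear (\<lambda>x y. - b x y)"
    using b by (auto simp: bilinear_def intro: linear_compose_neg)
  let ?D = "{dim U | U. subspace U \<and> U \<subseteq> T \<and> (\<forall>u\<in>U. u \<noteq> 0 \<longrightarrow> b u u > 0)}"
  have bound: "dim U \<le> card ?P" if U: "subspace U" "U \<subseteq> T" "\<forall>u\<in>U. u \<noteq> 0 \<longrightarrow> b u u > 0" for U
  proof -
    have "U \<inter> span ?N \<subseteq> {0}"
      using U(3) definite_on_span[OF mb ind(2) pw(2)] by force
    then have "dim (U \<inter> span ?N) = 0"
      using dim_subset[of "U \<inter> span ?N" "{0}"] by simp
    then have "dim {x + y |x y. x \<in> U \<and> y \<in> span ?N} = dim U + card ?N"
      using dim_sums_Int[OF U(1) subspace_span[of ?N]] dim_eq_card_independent[OF ind(2)]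
        dim_span[of ?N] by linarith
    moreover have "{x + y |x y. x \<in> U \<and> y \<in> span ?N} \<subseteq> T"
    proof -
      have "span ?N \<subseteq> T" unfolding B(2)[symmetric] by (intro span_mono) auto
      then show ?thesis using U(2) subspace_span[of B] by (auto simp: B(2) intro!: subspace_add)
    qed
    then have "dim {x + y |x y. x \<in> U \<and> y \<in> span ?N} \<le> card B"
      using dim_subset[of _ T] dim_eq_card_independent[OF B(1)] dim_span[of B] unfolding B(2) by simp
    moreover have "card B = card ?P + card ?N"
      using card_Un_disjoint[of ?P ?N] PN fin by simp
    ultimately show ?thesis by linarith
  qed
  have "card ?P \<in> ?D"
    using definite_on_span[OF b ind(1) pw(1)] dim_eq_card_independent[OF ind(1)]
      span_mono[of ?P B] B(2) subspace_span[of ?P]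
    by (intro CollectI exI[of _ "span ?P"]) auto
  moreover have "finite ?D" by (rule finite_subset[of _ "{..card ?P}"]) (use bound in auto)
  ultimately show ?thesis
    unfolding positive_index_def using bound by (intro Max_eqI) auto
qed

text \<open>For a nondegenerate form with \<open>q\<close> negative squares the signature is \<open>n - 2 q\<close> and the
  Gram determinant has sign \<open>(-1)^q\<close>: signature modulo 4 and sign of the determinant carry the
  same information.\<close>

lemma orthogonal_basis_signature:
  fixes b :: "'a::euclidean_space \<Rightarrow> 'a \<Rightarrow> real"
  assumes b: "bilinear b" "\<And>x y. b x y = b y x" and T: "subspace T" "dim T = CARD('n::finite)"
  shows "\<exists>X :: 'a^'n. (\<forall>i. X $ i \<in> T) \<and> inj (($) X) \<and> independent (range (($) X)) \<and> span (range (($) X)) = T \<and>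
    (det (\<chi> i j. b (X $ i) (X $ j)) \<noteq> 0 \<longrightarrow>
      (\<exists>q::nat. signature_on b T = int CARD('n) - 2 * int q \<and>
         sgn (det (\<chi> i j. b (X $ i) (X $ j))) = (-1) ^ q))"
proof -
  obtain B where B: "B \<subseteq> T" "independent B" "span B = T" "pairwise (\<lambda>x y. b x y = 0) B"
    using orthogonal_basis_exists[OF b T(1)] by (elim exE conjE) (rule that)
  have fin: "finite B" using B by (simp add: independent_imp_finite)
  have "card B = CARD('n)"
    using dim_eq_card_independent[OF B(2)] dim_span[of B] T(2) unfolding B(3) by simp
  then obtain f where f: "bij_betw f (UNIV::'n set) B"
    using finite_same_card_bij[of "UNIV::'n set" B] fin by auto
  define X where "X = (\<chi> i. f i)"
  have X: "($) X = f" by (auto simp: X_def)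
  have fB: "f i \<in> B" for i using f by (auto simp: bij_betw_def)
  have inj: "inj f" and ran: "range f = B" using f by (auto simp: bij_betw_def)
  have det: "det (\<chi> i j. b (X $ i) (X $ j)) = (\<Prod>x\<in>B. b x x)"
  proof -
    have "det (\<chi> i j. b (X $ i) (X $ j)) = (\<Prod>i\<in>UNIV. b (f i) (f i))"
      by (subst det_diagonal) (use B(4) fB inj in \<open>auto simp: X_def pairwise_def inj_eq\<close>)
    also have "\<dots> = (\<Prod>x\<in>B. b x x)" by (rule prod.reindex_bij_betw[OF f])
    finally show ?thesis .
  qed
  have "\<exists>q::nat. signature_on b T = int CARD('n) - 2 * int q \<and> sgn (\<Prod>x\<in>B. b x x) = (-1) ^ q"
    if "(\<Prod>x\<in>B. b x x) \<noteq> 0"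
  proof (intro exI[of _ "card {x \<in> B. b x x < 0}"] conjI)
    have nz: "b x x \<noteq> 0" if "x \<in> B" for x using \<open>(\<Prod>x\<in>B. b x x) \<noteq> 0\<close> that fin by auto
    have mb: "bilinear (\<lambda>x y. - b x y)"
      using b by (auto simp: bilinear_def intro: linear_compose_neg)
    have "positive_index b T = card {x \<in> B. b x x > 0}"
      by (rule positive_index_orthogonal_basis[OF b(1) B(2-4) nz])
    moreover have "positive_index (\<lambda>x y. - b x y) T = card {x \<in> B. - b x x > 0}"
      by (rule positive_index_orthogonal_basis[OF mb B(2,3)]) (use B(4) nz in \<open>auto simp: pairwise_def\<close>)
    moreover have "card B = card {x \<in> B. b x x > 0} + card {x \<in> B. b x x < 0}"
    proof -
      have "B = {x \<in> B. b x x > 0} \<union> {x \<in> B. b x x < 0}" using nz by force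
      then show ?thesis
        using fin card_Un_disjoint[of "{x \<in> B. b x x > 0}" "{x \<in> B. b x x < 0}"] by fastforce
    qed
    ultimately show "signature_on b T = int CARD('n) - 2 * int (card {x \<in> B. b x x < 0})"
      using \<open>card B = CARD('n)\<close> by (simp add: signature_on_def)
    have sgn_prod: "(\<Prod>x\<in>S. sgn (b x x)) = sgn (\<Prod>x\<in>S. b x x)" for S
      by (induction S rule: infinite_finite_induct) (auto simp: sgn_mult)
    have "sgn (\<Prod>x\<in>B. b x x) = (\<Prod>x\<in>B. if b x x < 0 then -1 else 1)"
      unfolding sgn_prod[symmetric] by (rule prod.cong) (use nz in \<open>auto simp: sgn_if\<close>)
    also have "\<dots> = (-1) ^ card {x \<in> B. b x x < 0}"
      using fin by (simp add: prod.If_cases Collect_conj_eq)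
    finally show "sgn (\<Prod>x\<in>B. b x x) = (-1) ^ card {x \<in> B. b x x < 0}" .
  qed
  then show ?thesis
    using B fB inj ran by (intro exI[of _ X]) (auto simp: det[unfolded X] X)
qed

lemma positive_index_cong_scale:
  assumes "a > 0" "\<And>u. u \<in> T \<Longrightarrow> b u u = a * b' u u"
  shows "positive_index b T = positive_index b' T"
proof -
  have "(\<forall>u\<in>U. u \<noteq> 0 \<longrightarrow> b u u > 0) = (\<forall>u\<in>U. u \<noteq> 0 \<longrightarrow> b' u u > 0)" if "U \<subseteq> T" for U
    using assms that by (simp add: subset_iff zero_less_mult_iff)
  then show ?thesis
    unfolding positive_index_def by (intro arg_cong[of _ _ Max] Collect_cong) auto
qed

lemma signature_on_cong_scale:
  assumes "a > 0" "\<And>u. u \<in> T \<Longrightarrow> b u u = a * b' u u"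
  shows "signature_on b T = signature_on b' T"
  unfolding signature_on_def
  using positive_index_cong_scale[where b = b and b' = b', OF assms]
    positive_index_cong_scale[where b = "\<lambda>u v. - b u v" and b' = "\<lambda>u v. - b' u v", OF assms(1)]
    assms(2) by simp

lemma mod_4_of_signature_eq_iff:
  "(int n - 2 * int p) mod 4 = (int n - 2 * int q) mod 4 \<longleftrightarrow> (-1::real) ^ p = (-1) ^ q"
proof -
  have "(int n - 2 * int p) mod 4 = (int n - 2 * int q) mod 4 \<longleftrightarrow> even p = even q"
    by presburger
  then show ?thesis by (auto simp: minus_one_power_iff)
qed

lemma det_adjoin_nonzero:
  fixes X :: "(real^('n::finite option))^'n"
  assumes "inj (($) X)" "independent (range (($) X))" "w \<notin> span (range (($) X))"
  shows "det (adjoin w X) \<noteq> 0"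
proof -
  have "rows (adjoin w X) = insert w (range (($) X))"
  proof -
    have "rows (adjoin w X) = range (($) (adjoin w X))"
      by (auto simp: rows_def row_def vec_lambda_eta)
    then show ?thesis by (simp add: UNIV_option_conv image_image adjoin_def)
  qed
  moreover have "independent (insert w (range (($) X)))"
    using assms by (simp add: independent_insert span_base)
  ultimately have "dim (rows (adjoin w X)) = card (insert w (range (($) X)))"
    using dim_eq_card_independent[of "insert w (range (($) X))"] by simp
  also have "\<dots> = CARD('n) + 1"
  proof -
    have "w \<notin> range (($) X)" using assms(3) span_base[of w "range (($) X)"] by argo
    then show ?thesis by (simp add: card_image[OF assms(1)])
  qed
  finally show ?thesis
    by (simp add: det_eq_0_rank row_rank_def)
qed


section \<open>Level sets of translationally homogeneous functions\<close>

lemma linear_real_eq_sum_axis: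
  fixes f :: "real^'m \<Rightarrow> real"
  assumes "linear f"
  shows "f v = (\<Sum>i\<in>UNIV. f (axis i 1) * v $ i)"
proof -
  have "f v = f (\<Sum>i\<in>UNIV. v $ i *\<^sub>R axis i 1)"
    using basis_expansion[of v] by (simp add: scalar_mult_eq_scaleR)
  also have "\<dots> = (\<Sum>i\<in>UNIV. f (axis i 1) * v $ i)"
    by (simp add: linear_sum[OF assms] linear_cmul[OF assms] mult.commute)
  finally show ?thesis .
qed

text \<open>Within a hypersurface the derivative of a field is not unique, but on the velocity of a curve
  in the hypersurface each derivative takes the value prescribed by the curve.\<close>

lemma has_derivative_along_curve:
  assumes "(Y has_derivative f') (at p within S)" "\<epsilon> > 0" "\<gamma> ` {-\<epsilon><..<\<epsilon>} \<subseteq> S" "\<gamma> (0::real) = p"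
    and "(\<gamma> has_vector_derivative v) (at 0)"
  shows "((\<lambda>t. Y (\<gamma> t)) has_derivative (\<lambda>h. h *\<^sub>R f' v)) (at 0)"
proof -
  have g: "(\<gamma> has_derivative (\<lambda>h. h *\<^sub>R v)) (at 0 within {-\<epsilon><..<\<epsilon>})"
    using assms(5) has_derivative_at_withinI by (auto simp: has_vector_derivative_def)
  have "(Y has_derivative f') (at (\<gamma> 0) within \<gamma> ` {-\<epsilon><..<\<epsilon>})"
    using has_derivative_subset[OF assms(1,3)] assms(4) by simp
  from has_derivative_in_compose[OF g this]
  have "((\<lambda>t. Y (\<gamma> t)) has_derivative (\<lambda>h. f' (h *\<^sub>R v))) (at 0)"
    using assms(2) at_within_open[of 0 "{-\<epsilon><..<\<epsilon>}"] by simp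
  then show ?thesis
    by (simp add: linear_cmul[OF has_derivative_linear[OF assms(1)]])
qed

lemma smooth_along_has_derivative:
  assumes "smooth_along S Y" "p \<in> S"
  shows "(Y has_derivative deriv_along S Y p) (at p within S)"
proof -
  obtain O' N where O': "open O'" "p \<in> O'" "smooth_on N O'" "\<forall>q\<in>S \<inter> O'. N q = Y q"
    using bspec[OF assms(1)[unfolded smooth_along_def] assms(2)] by (elim exE conjE) (rule that)
  have "Ck_on (Suc 0) N O'" using O'(3) by (simp only: smooth_on_def)
  then have N: "(N has_derivative frechet_derivative N (at p)) (at p within S)"
    by (rule has_derivative_at_withinI[OF Ck_on_SucD(1)[OF _ O'(2)]])
  obtain d where d: "d > 0" "ball p d \<subseteq> O'" using O' openE by blast
  have "(Y has_derivative frechet_derivative N (at p)) (at p within S)"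
    by (rule has_derivative_transform_within[OF N d(1) assms(2)])
      (use d O'(4) in \<open>auto simp: dist_commute subset_iff\<close>)
  then show ?thesis
    unfolding deriv_along_def[abs_def] using differentiableI frechet_derivative_works by blast
qed

lemma smooth_along_const: "smooth_along S (\<lambda>_. w)"
  unfolding smooth_along_def smooth_on_def
  by (intro ballI exI[of _ UNIV] exI[of _ "\<lambda>_. w"]) (simp add: Ck_on_const)

lemma smooth_along_cong:
  assumes "\<And>p. p \<in> S \<Longrightarrow> N p = N' p"
  shows "smooth_along S N = smooth_along S N'"
proof -
  have "(\<forall>q\<in>S \<inter> G. M q = N q) = (\<forall>q\<in>S \<inter> G. M q = N' q)" for G M
    using assms by auto
  then show ?thesis by (simp only: smooth_along_def)
qed

locale translationally_homogeneous =
  fixes F :: "real^'m \<Rightarrow> real" and U :: "(real^'m) set" and e :: "real^'m" and lam :: real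
  assumes open_U: "open U" and smooth: "smooth_on F U" and F_nonzero: "x \<in> U \<Longrightarrow> F x \<noteq> 0"
    and lam: "lam \<noteq> 0" and axis: "is_axis lam U F e"
begin

abbreviation dF :: "real^'m \<Rightarrow> real^'m \<Rightarrow> real"
  where "dF x \<equiv> frechet_derivative F (at x)"

abbreviation level :: "real \<Rightarrow> (real^'m) set"
  where "level r \<equiv> level_set F U r"

lemma level_iff: "p \<in> level r \<longleftrightarrow> p \<in> U \<and> F p = r"
  by (simp add: level_set_def)

lemma Ck_F: "Ck_on k F U"
  using smooth by (simp add: smooth_on_def)

lemma Ck_dF: "Ck_on k (\<lambda>x. dF x v) U"
  using Ck_F[of "Suc k"] by simp

lemma dF: "x \<in> U \<Longrightarrow> (F has_derivative dF x) (at x)"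
  using Ck_on_SucD(1)[OF Ck_F[of 1, unfolded One_nat_def]] .

lemma linear_dF: "x \<in> U \<Longrightarrow> linear (dF x)"
  using dF has_derivative_linear by blast

lemma dF_has_derivative: "x \<in> U \<Longrightarrow> ((\<lambda>y. dF y v) has_derivative (\<lambda>u. hess F x u v)) (at x)"
  using Ck_on_SucD(1)[OF Ck_dF[of "Suc 0"]] by (simp add: hess_def)

lemma hess_commute: "x \<in> U \<Longrightarrow> hess F x u v = hess F x v u"
  by (rule hess_sym[OF open_U Ck_F])

lemma bilinear_hess: "x \<in> U \<Longrightarrow> bilinear (hess F x)"
proof -
  assume x: "x \<in> U"
  have l: "linear (\<lambda>u. hess F x u v)" for v
    by (rule has_derivative_linear[OF dF_has_derivative[OF x]])
  moreover have "linear (\<lambda>v. hess F x u v)" for u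
    using l[of u] hess_commute[OF x] by simp
  ultimately show ?thesis by (simp add: bilinear_def)
qed

subsection \<open>Homogeneity of the derivatives\<close>

lemma homogeneous_derivative_axis:
  assumes hom: "\<And>x t. x \<in> U \<Longrightarrow> x + t *\<^sub>R e \<in> U \<Longrightarrow> f (x + t *\<^sub>R e) = exp (lam * t) * f x"
    and x: "x \<in> U" and f': "(f has_derivative f') (at x)"
  shows "f' e = lam * f x"
proof -
  have l: "((\<lambda>t. x + t *\<^sub>R e) has_derivative (\<lambda>h. h *\<^sub>R e)) (at 0)"
    by (auto intro!: derivative_eq_intros)
  have 1: "((\<lambda>t. f (x + t *\<^sub>R e)) has_derivative (\<lambda>h. f' (h *\<^sub>R e))) (at 0)"
    using has_derivative_compose[OF l, of f f'] f' by simp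
  have op: "open ((\<lambda>t. x + t *\<^sub>R e) -` U)"
    by (intro open_vimage open_U continuous_intros)
  have "((\<lambda>t. exp (lam * t) * f x) has_derivative (\<lambda>h. h * (lam * f x))) (at 0)"
    by (auto intro!: derivative_eq_intros)
  from has_derivative_transform_within_open[OF this op]
  have 2: "((\<lambda>t. f (x + t *\<^sub>R e)) has_derivative (\<lambda>h. h * (lam * f x))) (at 0)"
    using x hom by simp
  from fun_cong[OF has_derivative_unique[OF 1 2], of 1] show ?thesis by simp
qed

lemma homogeneous_derivative_translate:
  assumes hom: "\<And>x t. x \<in> U \<Longrightarrow> x + t *\<^sub>R e \<in> U \<Longrightarrow> f (x + t *\<^sub>R e) = exp (lam * t) * f x"
    and f': "\<And>x. x \<in> U \<Longrightarrow> (f has_derivative f' x) (at x)"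
    and x: "x \<in> U" "x + t *\<^sub>R e \<in> U"
  shows "f' (x + t *\<^sub>R e) v = exp (lam * t) * f' x v"
proof -
  have l: "((\<lambda>y. y + t *\<^sub>R e) has_derivative (\<lambda>h. h)) (at x)"
    by (auto intro!: derivative_eq_intros)
  have 1: "((\<lambda>y. f (y + t *\<^sub>R e)) has_derivative f' (x + t *\<^sub>R e)) (at x)"
    using has_derivative_compose[OF l f'[OF x(2)]] by simp
  have op: "open (U \<inter> (\<lambda>y. y + t *\<^sub>R e) -` U)"
    by (intro open_Int open_vimage open_U continuous_intros)
  have "((\<lambda>y. exp (lam * t) * f y) has_derivative (\<lambda>h. exp (lam * t) * f' x h)) (at x)"
    by (rule has_derivative_mult_right[OF f'[OF x(1)]])
  from has_derivative_transform_within_open[OF this op]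
  have 2: "((\<lambda>y. f (y + t *\<^sub>R e)) has_derivative (\<lambda>h. exp (lam * t) * f' x h)) (at x)"
    using x hom by simp
  from fun_cong[OF has_derivative_unique[OF 1 2]] show ?thesis by simp
qed

lemma F_translate: "x \<in> U \<Longrightarrow> x + t *\<^sub>R e \<in> U \<Longrightarrow> F (x + t *\<^sub>R e) = exp (lam * t) * F x"
  using axis by (simp add: is_axis_def)

lemma dF_translate:
  "x \<in> U \<Longrightarrow> x + t *\<^sub>R e \<in> U \<Longrightarrow> dF (x + t *\<^sub>R e) v = exp (lam * t) * dF x v"
  by (rule homogeneous_derivative_translate[OF F_translate dF])

lemma hess_translate:
  "x \<in> U \<Longrightarrow> x + t *\<^sub>R e \<in> U \<Longrightarrow> hess F (x + t *\<^sub>R e) u v = exp (lam * t) * hess F x u v"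
  by (rule homogeneous_derivative_translate[OF dF_translate dF_has_derivative])

lemma dF_axis: "x \<in> U \<Longrightarrow> dF x e = lam * F x"
  by (rule homogeneous_derivative_axis[OF F_translate _ dF])

lemma hess_axis: "x \<in> U \<Longrightarrow> hess F x e v = lam * dF x v"
  by (rule homogeneous_derivative_axis[OF dF_translate _ dF_has_derivative])

lemma dF_axis_nonzero: "x \<in> U \<Longrightarrow> dF x e \<noteq> 0"
  using dF_axis lam F_nonzero by simp


subsection \<open>Sliding onto a level set along the axis\<close>

text \<open>Translation along the axis multiplies \<open>F\<close> by an exponential, so the translate of \<open>q\<close> on
  which \<open>F\<close> takes the value \<open>r\<close> can be written down. This gives curves, connectedness and tangent
  spaces of level sets without the implicit function theorem.\<close>

definition slide :: "real \<Rightarrow> real^'m \<Rightarrow> real^'m"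
  where "slide r q = q - (ln (F q / r) / lam) *\<^sub>R e"

lemma slide_level: "p \<in> level r \<Longrightarrow> slide r p = p"
  using F_nonzero by (auto simp: slide_def level_iff)

lemma slide_in_level:
  assumes "q \<in> U" "F q / r > 0" "slide r q \<in> U"
  shows "slide r q \<in> level r"
proof -
  have "F (slide r q) = exp (lam * - (ln (F q / r) / lam)) * F q"
    using F_translate[OF assms(1), of "- (ln (F q / r) / lam)"] assms(3) by (simp add: slide_def)
  also have "\<dots> = r"
    using assms(2) lam by (cases "F q = 0") (auto simp: exp_minus)
  finally show ?thesis using assms(3) by (simp add: level_iff)
qed

lemma slide_neighbourhood:
  assumes p: "p \<in> level r"
  obtains V where "open V" "convex V" "p \<in> V"
    "slide r ` V \<subseteq> level r" "smooth_on (slide r) V"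
proof -
  have r: "p \<in> U" "F p = r" "r \<noteq> 0" using p F_nonzero by (auto simp: level_iff)
  define W where "W = U \<inter> (\<lambda>q. F q / r) -` {0<..}"
  have cF: "continuous_on U F" using Ck_F[of 0] by simp
  have oW: "open W"
    unfolding W_def using r by (intro continuous_open_preimage open_U continuous_intros cF) auto
  have WU: "W \<subseteq> U" and pos: "\<And>q. q \<in> W \<Longrightarrow> F q / r > 0" by (auto simp: W_def)
  have Ck: "Ck_on k (slide r) W" for k
  proof -
    have f: "Ck_on k F W" by (rule Ck_on_subset[OF Ck_F WU])
    have "Ck_on k (\<lambda>q. F q / r) W"
      using Ck_on_bounded_linear[OF bounded_linear_divide oW f] .
    from Ck_on_ln[OF oW pos this]
    have l: "Ck_on k (\<lambda>q. ln (F q / r)) W" .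
    have bl: "bounded_linear (\<lambda>s. (s / lam) *\<^sub>R e)"
      by (intro bounded_linear_scaleR_const bounded_linear_divide)
    show ?thesis
      unfolding slide_def[abs_def]
      by (intro Ck_on_diff[OF oW] Ck_on_ident Ck_on_bounded_linear[OF bl oW l])
  qed
  have cs: "continuous_on W (slide r)" using Ck[of 0] by simp
  have o: "open (W \<inter> slide r -` U)"
    by (rule continuous_open_preimage[OF cs oW open_U])
  have "p \<in> W \<inter> slide r -` U"
    using r slide_level[OF p] by (simp add: W_def)
  then obtain d where d: "d > 0" "ball p d \<subseteq> W \<inter> slide r -` U"
    using o openE by blast
  show thesis
  proof (rule that[of "ball p d"])
    show "slide r ` ball p d \<subseteq> level r"
      using d WU pos by (auto intro!: slide_in_level)
    show "smooth_on (slide r) (ball p d)"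
      unfolding smooth_on_def using Ck_on_subset[OF Ck] d by blast
  qed (use d WU pos in auto)
qed

lemma slide_has_derivative:
  assumes "p \<in> level r"
  shows "(slide r has_derivative (\<lambda>v. v - (dF p v / (lam * r)) *\<^sub>R e)) (at p)"
proof -
  have p: "p \<in> U" "F p = r" "r \<noteq> 0" using assms F_nonzero by (auto simp: level_iff)
  have "((\<lambda>q. F q / r) has_derivative (\<lambda>v. dF p v / r)) (at p)"
    by (rule bounded_linear.has_derivative[OF bounded_linear_divide dF[OF p(1)]])
  from has_derivative_ln[OF _ this] p
  have "((\<lambda>q. ln (F q / r)) has_derivative (\<lambda>v. dF p v / r)) (at p)"
    by simp
  from bounded_linear.has_derivative[OF bounded_linear_scaleR_const[OF bounded_linear_divide[of lam], of e] this]
  show ?thesis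
    unfolding slide_def[abs_def]
    by (intro has_derivative_diff has_derivative_ident) (simp add: mult.commute)
qed

text \<open>Statements about components of level sets, and about the neighbourhoods that occur in the
  definition of the second fundamental form, are covered by working with relatively open subsets
  of a level set. A vector in the kernel of \<open>dF\<close> is tangent because the slide of the line in its
  direction is a curve with that velocity.\<close>

lemma tangent_space_level:
  assumes S: "openin (top_of_set (level r)) S" and p: "p \<in> S"
  shows "tangent_space S p = {v. dF p v = 0}"
proof (intro equalityI subsetI)
  have pl: "p \<in> level r" using openin_imp_subset[OF S] p by blast
  then have pU: "p \<in> U" by (simp add: level_iff)
  fix v assume "v \<in> tangent_space S p"
  then obtain \<gamma> \<epsilon> where g: "\<epsilon> > 0" "\<gamma> ` {-\<epsilon><..<\<epsilon>} \<subseteq> S" "\<gamma> (0::real) = p"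
    "(\<gamma> has_vector_derivative v) (at 0)"
    unfolding tangent_space_def by blast
  have 1: "((\<lambda>t. F (\<gamma> t)) has_derivative (\<lambda>h. h *\<^sub>R dF p v)) (at 0)"
    by (rule has_derivative_along_curve[OF has_derivative_at_withinI[OF dF[OF pU]] g])
  have 2: "((\<lambda>t. F (\<gamma> t)) has_derivative (\<lambda>h. 0)) (at 0)"
    by (rule has_derivative_transform_within_open[OF has_derivative_const[of r], of "{-\<epsilon><..<\<epsilon>}"])
      (use g openin_imp_subset[OF S] in \<open>force simp: level_iff\<close>)+
  from fun_cong[OF has_derivative_unique[OF 1 2], of 1] show "v \<in> {v. dF p v = 0}" by simp
next
  have pl: "p \<in> level r" using openin_imp_subset[OF S] p by blast
  then have pU: "p \<in> U" by (simp add: level_iff)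
  fix v assume "v \<in> {v. dF p v = 0}"
  then have v: "dF p v = 0" by simp
  obtain G where G: "open G" "S = level r \<inter> G" using S by (auto simp: openin_open)
  obtain V where V: "open V" "p \<in> V" "slide r ` V \<subseteq> level r" "smooth_on (slide r) V"
    using slide_neighbourhood[OF pl] by metis
  have "continuous_on V (slide r)" using V(4) by (metis Ck_on.simps(1) smooth_on_def)
  then have oV: "open (V \<inter> slide r -` G)"
    by (rule continuous_open_preimage[OF _ V(1) G(1)])
  define \<gamma> where "\<gamma> t = slide r (p + t *\<^sub>R v)" for t
  have "open ((\<lambda>t. p + t *\<^sub>R v) -` (V \<inter> slide r -` G))"
    by (intro open_vimage oV continuous_intros)
  moreover have "0 \<in> (\<lambda>t. p + t *\<^sub>R v) -` (V \<inter> slide r -` G)"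
    using V p G slide_level[OF pl] by simp
  ultimately obtain \<epsilon> where \<epsilon>: "\<epsilon> > 0" "ball 0 \<epsilon> \<subseteq> (\<lambda>t. p + t *\<^sub>R v) -` (V \<inter> slide r -` G)"
    using openE by blast
  have inV: "p + t *\<^sub>R v \<in> V" "\<gamma> t \<in> G" if "t \<in> {-\<epsilon><..<\<epsilon>}" for t
    using \<epsilon>(2) that by (auto simp: \<gamma>_def subset_iff dist_real_def)
  have "smooth_on \<gamma> {-\<epsilon><..<\<epsilon>}"
    unfolding smooth_on_def \<gamma>_def[abs_def]
    by (intro allI Ck_on_line[OF V(1)]) (use inV V(4) in \<open>auto simp: smooth_on_def\<close>)
  moreover have "\<gamma> ` {-\<epsilon><..<\<epsilon>} \<subseteq> S"
    using inV V(3) by (auto simp: G \<gamma>_def)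
  moreover have "\<gamma> 0 = p" by (simp add: \<gamma>_def slide_level[OF pl])
  moreover have "(\<gamma> has_vector_derivative v) (at 0)"
  proof -
    have l: "((\<lambda>t. p + t *\<^sub>R v) has_derivative (\<lambda>h. h *\<^sub>R v)) (at 0)"
      by (auto intro!: derivative_eq_intros)
    have "(slide r has_derivative (\<lambda>v. v - (dF p v / (lam * r)) *\<^sub>R e)) (at (p + 0 *\<^sub>R v))"
      using slide_has_derivative[OF pl] by simp
    from has_derivative_compose[OF l this] show ?thesis
      using linear_cmul[OF linear_dF[OF pU]] v by (simp add: \<gamma>_def[abs_def] has_vector_derivative_def)
  qed
  ultimately show "v \<in> tangent_space S p"
    unfolding tangent_space_def using \<epsilon>(1) by blast
qed

text \<open>The slide of a small convex neighbourhood of \<open>p\<close> is a connected part of the level set which contains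
  all points of the level set near \<open>p\<close>.\<close>

lemma openin_component_level:
  assumes C: "C \<in> components (level r)"
  shows "openin (top_of_set (level r)) C"
proof (subst openin_subopen, intro ballI)
  fix p assume p: "p \<in> C"
  then have pl: "p \<in> level r" using in_components_subset[OF C] by blast
  obtain V where V: "open V" "convex V" "p \<in> V" "slide r ` V \<subseteq> level r" "smooth_on (slide r) V"
    using slide_neighbourhood[OF pl] by metis
  have "continuous_on V (slide r)" using V(5) by (metis Ck_on.simps(1) smooth_on_def)
  then have "connected (slide r ` V)"
    using connected_continuous_image convex_connected[OF V(2)] by blast
  moreover have "p \<in> slide r ` V" using V(3) slide_level[OF pl] by (metis image_eqI)
  ultimately have "slide r ` V \<subseteq> C"
    using components_maximal[OF C _ V(4)] p by blast
  moreover have "level r \<inter> V \<subseteq> slide r ` V" using slide_level by (metis IntE image_eqI subsetI)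
  ultimately show "\<exists>T. openin (top_of_set (level r)) T \<and> p \<in> T \<and> T \<subseteq> C"
    using V pl by (intro exI[of _ "level r \<inter> V"]) auto
qed

lemma hypersurface_level:
  assumes S: "openin (top_of_set (level r)) S"
  shows "hypersurface S"
  unfolding hypersurface_def
proof
  fix p assume p: "p \<in> S"
  obtain G where G: "open G" "S = level r \<inter> G" using S by (auto simp: openin_open)
  have d: "frechet_derivative (\<lambda>q. F q - r) (at q) = dF q" if "q \<in> U" for q
  proof -
    have "((\<lambda>q. F q - r) has_derivative dF q) (at q)"
      using has_derivative_diff[OF dF[OF that] has_derivative_const] by simp
    then show ?thesis using frechet_derivative_at by metis
  qed
  have oUG: "open (U \<inter> G)" using open_U G by blast
  have "Ck_on k (\<lambda>q. F q - r) (U \<inter> G)" for k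
    by (intro Ck_on_diff[OF oUG] Ck_on_const Ck_on_subset[OF Ck_F]) auto
  moreover have "dF q \<noteq> (\<lambda>_. 0)" if "q \<in> U" for q
    using dF_axis_nonzero[OF that] by metis
  moreover have "S \<inter> (U \<inter> G) = {q \<in> U \<inter> G. F q - r = 0}"
    by (auto simp: G level_iff)
  ultimately show "\<exists>U G. open U \<and> p \<in> U \<and> smooth_on (G :: real^'m \<Rightarrow> real) U \<and>
        (\<forall>q\<in>U. frechet_derivative G (at q) \<noteq> (\<lambda>_. 0)) \<and> S \<inter> U = {q \<in> U. G q = 0}"
    using oUG p G d
    by (intro exI[of _ "U \<inter> G"] exI[of _ "\<lambda>q. F q - r"]) (auto simp: smooth_on_def level_iff)
qed


subsection \<open>The second fundamental form\<close>

text \<open>Differentiating \<open>dF(Y) = 0\<close> along the level set gives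
  \<open>dF(\<partial>\<^sub>X Y) = - Hess F(X, Y)\<close>.\<close>

lemma dF_deriv_along:
  assumes S: "openin (top_of_set (level r)) S" and p: "p \<in> S"
    and Y: "smooth_along S Y" "\<And>q. q \<in> S \<Longrightarrow> dF q (Y q) = 0" and X: "dF p X = 0"
  shows "dF p (deriv_along S Y p X) = - hess F p X (Y p)"
proof -
  have SU: "S \<subseteq> U" using openin_imp_subset[OF S] by (auto simp: level_iff)
  then have pU: "p \<in> U" using p by blast
  let ?f' = "deriv_along S Y p"
  have "X \<in> tangent_space S p" using tangent_space_level[OF S p] X by simp
  then obtain \<gamma> \<epsilon> where g: "\<epsilon> > 0" "\<gamma> ` {-\<epsilon><..<\<epsilon>} \<subseteq> S" "\<gamma> (0::real) = p"
    "(\<gamma> has_vector_derivative X) (at 0)"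
    unfolding tangent_space_def by blast
  have dY: "((\<lambda>t. Y (\<gamma> t)) has_derivative (\<lambda>h. h *\<^sub>R ?f' X)) (at 0)"
    by (rule has_derivative_along_curve[OF smooth_along_has_derivative[OF Y(1) p] g])
  have dD: "((\<lambda>t. dF (\<gamma> t) v) has_derivative (\<lambda>h. h *\<^sub>R hess F p X v)) (at 0)" for v
    by (rule has_derivative_along_curve[OF has_derivative_at_withinI[OF dF_has_derivative[OF pU]] g])
  have "((\<lambda>t. \<Sum>i\<in>UNIV. dF (\<gamma> t) (axis i 1) * Y (\<gamma> t) $ i) has_derivative
      (\<lambda>h. \<Sum>i\<in>UNIV. dF (\<gamma> 0) (axis i 1) * (h *\<^sub>R ?f' X) $ i + h *\<^sub>R hess F p X (axis i 1) * Y (\<gamma> 0) $ i)) (at 0)"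
    by (intro has_derivative_sum has_derivative_mult dD
        bounded_linear.has_derivative[OF bounded_linear_vec_nth dY])
  then have 1: "((\<lambda>t. \<Sum>i\<in>UNIV. dF (\<gamma> t) (axis i 1) * Y (\<gamma> t) $ i) has_derivative
      (\<lambda>h. \<Sum>i\<in>UNIV. dF p (axis i 1) * (h *\<^sub>R ?f' X) $ i + h *\<^sub>R hess F p X (axis i 1) * Y p $ i)) (at 0)"
    by (simp add: g(3))
  have 2: "((\<lambda>t. \<Sum>i\<in>UNIV. dF (\<gamma> t) (axis i 1) * Y (\<gamma> t) $ i) has_derivative (\<lambda>h. 0)) (at 0)"
  proof (rule has_derivative_transform_within_open[OF has_derivative_const[of 0], of "{-\<epsilon><..<\<epsilon>}"])
    fix t assume "t \<in> {-\<epsilon><..<\<epsilon>}"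
    then have t: "\<gamma> t \<in> S" using g(2) by blast
    then show "0 = (\<Sum>i\<in>UNIV. dF (\<gamma> t) (axis i 1) * Y (\<gamma> t) $ i)"
      using linear_real_eq_sum_axis[OF linear_dF, of "\<gamma> t" "Y (\<gamma> t)"] Y(2)[OF t] SU by auto
  qed (use g in auto)
  have "linear (hess F p X)" using bilinear_hess[OF pU] by (simp add: bilinear_def)
  then have "dF p (?f' X) + hess F p X (Y p) = (\<Sum>i\<in>UNIV. dF p (axis i 1) * ?f' X $ i + hess F p X (axis i 1) * Y p $ i)"
    using linear_real_eq_sum_axis[of "hess F p X" "Y p"] linear_real_eq_sum_axis[OF linear_dF[OF pU], of "?f' X"]
    by (simp add: sum.distrib)
  also have "\<dots> = 0"
    using fun_cong[OF has_derivative_unique[OF 1 2], of 1] by simp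
  finally show ?thesis by linarith
qed

lemma second_ff_level:
  assumes S: "openin (top_of_set (level r)) S" and p: "p \<in> S"
    and N: "dF p (N p) \<noteq> 0" and X: "dF p X = 0" and Z: "dF p Z = 0"
  shows "second_ff S N p X Z = - hess F p X Z / dF p (N p)"
proof -
  have Sl: "S \<subseteq> level r" using openin_imp_subset[OF S] .
  then have SU: "S \<subseteq> U" by (auto simp: level_iff)
  then have pU: "p \<in> U" using p by blast
  have r: "r \<noteq> 0" using subsetD[OF Sl p] F_nonzero by (auto simp: level_iff)
  have tan: "tangent_space S q = {v. dF q v = 0}" if "q \<in> S" for q
    by (rule tangent_space_level[OF S that])
  have iff: "deriv_along (S \<inter> G) Y p X - c *\<^sub>R N p \<in> tangent_space S p \<longleftrightarrow> c = - hess F p X Z / dF p (N p)"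
    if "open G" "p \<in> G" "smooth_along (S \<inter> G) Y" "\<forall>q\<in>S \<inter> G. Y q \<in> tangent_space S q" "Y p = Z" for G Y c
  proof -
    have SG: "openin (top_of_set (level r)) (S \<inter> G)"
      using S that(1) by (auto simp: openin_open)
    have "dF p (deriv_along (S \<inter> G) Y p X) = - hess F p X (Y p)"
      by (rule dF_deriv_along[OF SG _ that(3) _ X]) (use that p tan in auto)
    then show ?thesis
      unfolding tan[OF p] using N that(5) linear_dF[OF pU]
      by (auto simp: linear_diff linear_cmul field_simps)
  qed
  \<comment> \<open>A tangent field with value \<open>Z\<close> at \<open>p\<close>, obtained by projecting the constant field \<open>Z\<close> along the
    axis. Without one, the defining condition on \<open>c\<close> would be vacuous.\<close>
  define Y where "Y q = Z - (dF q Z / (lam * r)) *\<^sub>R e" for q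
  have bl: "bounded_linear (\<lambda>s. (s / (lam * r)) *\<^sub>R e)"
    by (intro bounded_linear_scaleR_const bounded_linear_divide)
  have "smooth_on Y U"
    unfolding smooth_on_def Y_def[abs_def]
    by (intro allI Ck_on_diff[OF open_U] Ck_on_const Ck_on_bounded_linear[OF bl open_U Ck_dF])
  then have Y: "smooth_along (S \<inter> UNIV) Y"
    unfolding smooth_along_def using open_U SU by auto
  have Yt: "\<forall>q\<in>S \<inter> UNIV. Y q \<in> tangent_space S q"
  proof
    fix q assume q: "q \<in> S \<inter> UNIV"
    then have "q \<in> U" "F q = r" using Sl by (auto simp: level_iff)
    then show "Y q \<in> tangent_space S q"
      using tan q lam r by (simp add: Y_def linear_diff[OF linear_dF] linear_cmul[OF linear_dF] dF_axis)
  qed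
  have Yp: "Y p = Z" by (simp add: Y_def Z)
  show ?thesis
    unfolding second_ff_def
  proof (rule the_equality)
    show "\<forall>G Y. open G \<and> p \<in> G \<and> smooth_along (S \<inter> G) Y \<and> (\<forall>q\<in>S \<inter> G. Y q \<in> tangent_space S q) \<and> Y p = Z
      \<longrightarrow> deriv_along (S \<inter> G) Y p X - (- hess F p X Z / dF p (N p)) *\<^sub>R N p \<in> tangent_space S p"
      using iff by blast
  next
    fix c
    assume "\<forall>G Y. open G \<and> p \<in> G \<and> smooth_along (S \<inter> G) Y \<and> (\<forall>q\<in>S \<inter> G. Y q \<in> tangent_space S q) \<and> Y p = Z
      \<longrightarrow> deriv_along (S \<inter> G) Y p X - c *\<^sub>R N p \<in> tangent_space S p"
    then have "deriv_along (S \<inter> UNIV) Y p X - c *\<^sub>R N p \<in> tangent_space S p"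
      using Y Yt Yp by blast
    then show "c = - hess F p X Z / dF p (N p)"
      using iff[OF open_UNIV UNIV_I Y Yt Yp] by blast
  qed
qed

text \<open>A derivative of a constant field within the level set vanishes at least on tangent vectors,
  where it is determined by the values along curves.\<close>

lemma connection_form_const:
  assumes S: "openin (top_of_set (level r)) S" and p: "p \<in> S"
    and w: "dF p w \<noteq> 0" and X: "X \<in> tangent_space S p"
  shows "connection_form S (\<lambda>_. w) p X = 0"
proof -
  have pU: "p \<in> U" using openin_imp_subset[OF S] p by (auto simp: level_iff)
  obtain \<gamma> \<epsilon> where g: "\<epsilon> > 0" "\<gamma> ` {-\<epsilon><..<\<epsilon>} \<subseteq> S" "\<gamma> (0::real) = p"
    "(\<gamma> has_vector_derivative X) (at 0)"
    using X unfolding tangent_space_def by blast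
  have 1: "((\<lambda>t. w) has_derivative (\<lambda>h. h *\<^sub>R deriv_along S (\<lambda>_. w) p X)) (at (0::real))"
    by (rule has_derivative_along_curve[OF smooth_along_has_derivative[OF smooth_along_const p] g])
  have "deriv_along S (\<lambda>_. w) p X = 0"
    using fun_cong[OF has_derivative_unique[OF 1 has_derivative_const], of 1] by simp
  then show ?thesis
    unfolding connection_form_def tangent_space_level[OF S p]
    using w by (simp add: linear_cmul[OF linear_dF[OF pU]] linear_neg[OF linear_dF[OF pU]])
qed

end


section \<open>The Hessian determinant\<close>

lemma parallel_volume_form_eq_det:
  assumes "parallel_volume_form \<Psi>"
  shows "\<Psi> v = det v * \<Psi> (mat 1)" and "\<Psi> (mat 1) \<noteq> 0"
proof -
  show eq: "\<Psi> v = det v * \<Psi> (mat 1)" for v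
    using assms unfolding parallel_volume_form_def by (intro alternating_form_eq_det) blast+
  obtain v where "\<Psi> v \<noteq> 0"
    using assms unfolding parallel_volume_form_def by (elim conjE exE) (rule that)
  then show "\<Psi> (mat 1) \<noteq> 0" using eq[of v] by auto
qed

lemma parallel_volume_form_adjoin_scale:
  fixes \<Psi> :: "(real^('n::finite option))^('n option) \<Rightarrow> real"
  assumes "parallel_volume_form \<Psi>"
  shows "\<Psi> (adjoin (c *\<^sub>R w) X) = c * \<Psi> (adjoin w X)"
proof -
  have "linear (\<lambda>x. \<Psi> (\<chi> j. if j = None then x else adjoin 0 X $ j))"
    using assms unfolding parallel_volume_form_def by blast
  moreover have "(\<chi> j. if j = None then x else adjoin 0 X $ j) = adjoin x X" for x
    by (simp add: adjoin_def vec_eq_iff split: option.split)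
  ultimately have "linear (\<lambda>x. \<Psi> (adjoin x X))" by simp
  from linear_cmul[OF this] show ?thesis by simp
qed

context translationally_homogeneous
begin

lemma hess_eq_matrix: "x \<in> U \<Longrightarrow> hess F x u v = u \<bullet> (hess_matrix F x *v v)"
proof -
  assume x: "x \<in> U"
  have l: "linear (\<lambda>u. hess F x u v)" "linear (hess F x u)" for u v
    using bilinear_hess[OF x] by (auto simp: bilinear_def)
  have "hess F x u v = (\<Sum>i\<in>UNIV. hess F x (axis i 1) v * u $ i)"
    by (rule linear_real_eq_sum_axis[OF l(1)])
  also have "\<dots> = (\<Sum>i\<in>UNIV. u $ i * (hess_matrix F x *v v) $ i)"
    using linear_real_eq_sum_axis[OF l(2), of "axis i 1" v for i]
    by (simp add: matrix_vector_mult_def hess_matrix_def mult.commute)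
  finally show ?thesis by (simp add: inner_vec_def)
qed

lemma gram_hess: "x \<in> U \<Longrightarrow>
  det (\<chi> i j. hess F x (v $ i) (v $ j)) = (det v)\<^sup>2 * det (hess_matrix F x)"
proof -
  assume x: "x \<in> U"
  have "(\<chi> i j. hess F x (v $ i) (v $ j)) = v ** hess_matrix F x ** transpose v"
  proof -
    have "u \<bullet> (M *v w) = (\<Sum>l\<in>UNIV. (\<Sum>k\<in>UNIV. u $ k * M $ k $ l) * w $ l)" for u w :: "real^'m" and M
      by (simp add: inner_vec_def matrix_vector_mult_def sum_distrib_left sum_distrib_right mult.assoc)
        (rule sum.swap)
    then show ?thesis
      by (simp add: vec_eq_iff hess_eq_matrix[OF x] matrix_matrix_mult_def transpose_def)
  qed
  then show ?thesis by (simp add: det_mul power2_eq_square)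
qed

lemma hess_det_eq:
  assumes \<Psi>: "parallel_volume_form \<Psi>" and x: "x \<in> U"
  shows "hess_det \<Psi> F x = det (hess_matrix F x) / (\<Psi> (mat 1))\<^sup>2"
  unfolding hess_det_def
proof (rule the_equality)
  note P = parallel_volume_form_eq_det[OF \<Psi>]
  show "\<forall>v. det (\<chi> i j. hess F x (v $ i) (v $ j)) = det (hess_matrix F x) / (\<Psi> (mat 1))\<^sup>2 * (\<Psi> v)\<^sup>2"
  proof
    fix v
    show "det (\<chi> i j. hess F x (v $ i) (v $ j)) = det (hess_matrix F x) / (\<Psi> (mat 1))\<^sup>2 * (\<Psi> v)\<^sup>2"
      unfolding P(1)[of v] gram_hess[OF x] using P(2) by (simp add: power_mult_distrib)
  qed
  fix c assume "\<forall>v. det (\<chi> i j. hess F x (v $ i) (v $ j)) = c * (\<Psi> v)\<^sup>2"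
  then have "det (hess_matrix F x) = c * (\<Psi> (mat 1))\<^sup>2"
    using gram_hess[OF x, of "mat 1"] by simp
  then show "c = det (hess_matrix F x) / (\<Psi> (mat 1))\<^sup>2" using P(2) by simp
qed

lemma hess_det_translate:
  assumes \<Psi>: "parallel_volume_form \<Psi>" and x: "x \<in> U" "x + t *\<^sub>R e \<in> U"
  shows "hess_det \<Psi> F (x + t *\<^sub>R e) = exp (lam * t) ^ CARD('m) * hess_det \<Psi> F x"
proof -
  have "hess_matrix F (x + t *\<^sub>R e) = (\<chi> i. exp (lam * t) *s hess_matrix F x $ i)"
    by (simp add: hess_matrix_def vec_eq_iff hess_translate[OF x])
  then have "det (hess_matrix F (x + t *\<^sub>R e)) = exp (lam * t) ^ CARD('m) * det (hess_matrix F x)"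
    using det_rows_mul[of "\<lambda>_. exp (lam * t)" "\<lambda>i. hess_matrix F x $ i"] by simp
  then show ?thesis by (simp add: hess_det_eq[OF \<Psi>] x)
qed

lemma dF_eq_dcomp: "x \<in> U \<Longrightarrow> dF x v = dcomp F x \<bullet> v"
  using linear_real_eq_sum_axis[OF linear_dF, of x v] by (simp add: dcomp_def inner_vec_def)

text \<open>The homogeneity relation \<open>F\<^sub>i\<^sub>j e\<^sup>j = \<lambda> F\<^sub>i\<close> identifies the gradient with respect to the
  Hessian metric as a multiple of the axis.\<close>

lemma raised_differential_eq:
  assumes x: "x \<in> U" and nd: "det (hess_matrix F x) \<noteq> 0"
  shows "raised_differential F x = (1 / lam) *\<^sub>R e"
proof -
  let ?M = "hess_matrix F x"
  have "u \<bullet> (?M *v e) = u \<bullet> (lam *\<^sub>R dcomp F x)" for u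
    using hess_eq_matrix[OF x, of u e] hess_commute[OF x, of u e] hess_axis[OF x, of u] dF_eq_dcomp[OF x, of u]
    by (simp add: inner_commute)
  then have M: "?M *v e = lam *\<^sub>R dcomp F x" by (metis vector_eq_ldot)
  have "invertible ?M" using nd by (simp add: invertible_det_nz)
  from someI_ex[OF this[unfolded invertible_def]]
  have inv: "matrix_inv ?M ** ?M = mat 1" by (simp add: matrix_inv_def)
  have "dcomp F x = ?M *v ((1 / lam) *\<^sub>R e)"
    using lam by (simp add: matrix_vector_mult_scaleR M)
  then have "raised_differential F x = (matrix_inv ?M ** ?M) *v ((1 / lam) *\<^sub>R e)"
    by (simp add: raised_differential_def matrix_vector_mul_assoc)
  then show ?thesis by (simp add: inv)
qed

lemma norm2_differential_eq:
  assumes x: "x \<in> U" and nd: "det (hess_matrix F x) \<noteq> 0"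
  shows "norm2_differential F x = F x"
proof -
  have "norm2_differential F x = dcomp F x \<bullet> ((1 / lam) *\<^sub>R e)"
    unfolding norm2_differential_def raised_differential_eq[OF assms]
    by (simp add: inner_vec_def mult.commute)
  also have "\<dots> = F x" using dF_eq_dcomp[OF x, of e] dF_axis[OF x] lam by (simp add: field_simps)
  finally show ?thesis .
qed

lemma subspace_ker_dF: "x \<in> U \<Longrightarrow> subspace {v. dF x v = 0}"
  using linear_dF[of x] by (auto simp: subspace_def linear_0 linear_add linear_cmul)

end


section \<open>Equiaffine normals of level sets\<close>

locale translationally_homogeneous_volume =
  translationally_homogeneous F U e lam
  for F :: "real^('n::finite option) \<Rightarrow> real" and U e lam +
  fixes \<Psi> :: "(real^('n option))^('n option) \<Rightarrow> real"
  assumes \<Psi>: "parallel_volume_form \<Psi>"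
begin

lemma hess_det_eq_0_iff: "x \<in> U \<Longrightarrow> hess_det \<Psi> F x = 0 \<longleftrightarrow> det (hess_matrix F x) = 0"
  using parallel_volume_form_eq_det(2)[OF \<Psi>] by (simp add: hess_det_eq[OF \<Psi>])

text \<open>As \<open>Hess F (e, X) = \<lambda> dF(X)\<close>, the axis is orthogonal to the level set with respect to the
  Hessian, so that the Gram matrix of the Hessian on \<open>e, X\<^sub>1, \<dots>, X\<^sub>n\<close> is block diagonal.\<close>

lemma hess_det_tangential:
  assumes x: "x \<in> U" and X: "\<And>i. dF x (X $ i) = 0"
  shows "hess_det \<Psi> F x * (\<Psi> (adjoin e X))\<^sup>2
    = lam\<^sup>2 * F x * det (\<chi> i j. hess F x (X $ i) (X $ j))"
proof -
  let ?v = "adjoin e X"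
  have "(\<chi> k l. hess F x (?v $ k) (?v $ l)) = (\<chi> k l. case k of
        None \<Rightarrow> (case l of None \<Rightarrow> lam\<^sup>2 * F x | Some j \<Rightarrow> 0)
      | Some i \<Rightarrow> (case l of None \<Rightarrow> 0 | Some j \<Rightarrow> (\<chi> i j. hess F x (X $ i) (X $ j)) $ i $ j))"
    using hess_axis[OF x] hess_commute[OF x, of _ e] dF_axis[OF x] X
    by (auto simp: vec_eq_iff adjoin_def power2_eq_square split: option.split)
  then have "det (\<chi> k l. hess F x (?v $ k) (?v $ l))
      = lam\<^sup>2 * F x * det (\<chi> i j. hess F x (X $ i) (X $ j))"
    by (simp only: det_option_block)
  moreover have "det (\<chi> k l. hess F x (?v $ k) (?v $ l)) = hess_det \<Psi> F x * (\<Psi> ?v)\<^sup>2"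
    unfolding gram_hess[OF x] hess_det_eq[OF \<Psi> x] parallel_volume_form_eq_det(1)[OF \<Psi>, of ?v]
    using parallel_volume_form_eq_det(2)[OF \<Psi>] by (simp add: power_mult_distrib)
  ultimately show ?thesis by simp
qed

lemma dim_ker_dF: "x \<in> U \<Longrightarrow> dim {v. dF x v = 0} = CARD('n)"
proof -
  assume x: "x \<in> U"
  have "dcomp F x \<noteq> 0" using dF_axis_nonzero[OF x] dF_eq_dcomp[OF x, of e] by auto
  then show ?thesis
    using dim_hyperplane[of "dcomp F x"] by (simp add: dF_eq_dcomp[OF x])
qed

text \<open>For a basis \<open>X\<close> of the tangent space that is orthogonal with respect to the Hessian, the Gram
  determinant in \<open>hess_det_tangential\<close> is the product of the \<open>Hess F(X\<^sub>i, X\<^sub>i)\<close>. Hence the sign of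
  the Hessian determinant records the parity of the number \<open>q\<close> of negative squares.\<close>

lemma tangent_basis:
  assumes x: "x \<in> U"
  obtains X :: "(real^('n option))^'n" where "\<And>i. dF x (X $ i) = 0" "\<Psi> (adjoin e X) \<noteq> 0"
    "hess_det \<Psi> F x \<noteq> 0 \<Longrightarrow> \<exists>q. signature_on (hess F x) {v. dF x v = 0} = int CARD('n) - 2 * int q
        \<and> sgn (hess_det \<Psi> F x) = sgn (F x) * (-1) ^ q"
proof -
  obtain X :: "(real^('n option))^'n" where X: "\<forall>i. X $ i \<in> {v. dF x v = 0}" "inj (($) X)"
      "independent (range (($) X))" "span (range (($) X)) = {v. dF x v = 0}"
      "det (\<chi> i j. hess F x (X $ i) (X $ j)) \<noteq> 0 \<longrightarrow>
      (\<exists>q::nat. signature_on (hess F x) {v. dF x v = 0} = int CARD('n) - 2 * int q \<and>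
         sgn (det (\<chi> i j. hess F x (X $ i) (X $ j))) = (-1) ^ q)"
    using orthogonal_basis_signature[OF bilinear_hess[OF x] hess_commute[OF x] subspace_ker_dF[OF x] dim_ker_dF[OF x]]
    by (elim exE conjE) (rule that)
  have t: "dF x (X $ i) = 0" for i using X(1) by simp
  have "det (adjoin e X) \<noteq> 0"
    by (rule det_adjoin_nonzero[OF X(2,3)]) (use X(4) dF_axis_nonzero[OF x] in simp)
  then have nz: "\<Psi> (adjoin e X) \<noteq> 0"
    using parallel_volume_form_eq_det[OF \<Psi>] by (metis mult_eq_0_iff)
  let ?D = "det (\<chi> i j. hess F x (X $ i) (X $ j)) :: real"
  have eq: "hess_det \<Psi> F x * (\<Psi> (adjoin e X))\<^sup>2 = lam\<^sup>2 * F x * ?D"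
    by (rule hess_det_tangential[OF x t])
  then have "sgn (hess_det \<Psi> F x * (\<Psi> (adjoin e X))\<^sup>2) = sgn (lam\<^sup>2 * F x * ?D)" by simp
  then have sg: "sgn (hess_det \<Psi> F x) = sgn (F x) * sgn ?D"
    using nz lam by (simp only: sgn_mult) (simp add: sgn_if)
  show thesis
  proof (rule that[OF t nz])
    assume "hess_det \<Psi> F x \<noteq> 0"
    then have "?D \<noteq> 0" using sg by (auto simp: sgn_zero_iff)
    then show "\<exists>q. signature_on (hess F x) {v. dF x v = 0} = int CARD('n) - 2 * int q
        \<and> sgn (hess_det \<Psi> F x) = sgn (F x) * (-1) ^ q"
      using X(5) sg by auto
  qed
qed

lemma transverse_field_const:
  assumes S: "openin (top_of_set (level r)) S" and c: "c \<noteq> 0"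
  shows "transverse_field S (\<lambda>_. c *\<^sub>R e)"
  unfolding transverse_field_def
proof (intro conjI ballI smooth_along_const)
  fix p assume p: "p \<in> S"
  then have "p \<in> U" using openin_imp_subset[OF S] by (auto simp: level_iff)
  then show "c *\<^sub>R e \<notin> tangent_space S p"
    using c dF_axis_nonzero by (simp add: tangent_space_level[OF S p] linear_cmul[OF linear_dF])
qed

text \<open>Along the level set \<open>F = r\<close> the form \<open>h\<close> of the field \<open>c e\<close> is \<open>- Hess F / (c \<lambda> r)\<close>, so that
  both densities in the normalization of the equiaffine normal are expressed by \<open>\<Psi>(e, X)\<close> and the
  Hessian determinant.\<close>

lemma equiaffine_normal_axis_iff:
  assumes S: "openin (top_of_set (level r)) S" and c: "c \<noteq> 0"
  shows "equiaffine_normal \<Psi> S (\<lambda>_. c *\<^sub>R e) \<longleftrightarrow>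
    (\<forall>p\<in>S. \<bar>hess_det \<Psi> F p\<bar> = \<bar>c * lam\<bar> ^ (CARD('n) + 2) * \<bar>r\<bar> ^ (CARD('n) + 1))"
proof -
  let ?n = "CARD('n)"
  have pU: "p \<in> U" and Fp: "F p = r" and r: "r \<noteq> 0" if "p \<in> S" for p
    using subsetD[OF openin_imp_subset[OF S] that] F_nonzero by (auto simp: level_iff)
  have dFN: "dF p (c *\<^sub>R e) = c * lam * r" if "p \<in> S" for p
    using linear_cmul[OF linear_dF[OF pU[OF that]], of c e] dF_axis[OF pU[OF that]] Fp[OF that] by simp
  have nz: "c * lam * r \<noteq> 0" if "p \<in> S" for p using c lam r[OF that] by simp
  have key: "sqrt \<bar>det (\<chi> i j. second_ff S (\<lambda>_. c *\<^sub>R e) p (X $ i) (X $ j))\<bar> = \<bar>\<Psi> (adjoin (c *\<^sub>R e) X)\<bar> \<longleftrightarrow>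
     \<bar>hess_det \<Psi> F p\<bar> * (\<Psi> (adjoin e X))\<^sup>2 =
       \<bar>c * lam\<bar> ^ (?n + 2) * \<bar>r\<bar> ^ (?n + 1) * (\<Psi> (adjoin e X))\<^sup>2"
    if p: "p \<in> S" and X: "\<And>i. dF p (X $ i) = 0" for p and X :: "(real^('n option))^'n"
  proof -
    define k where "k = c * lam * r"
    have k: "k \<noteq> 0" using nz[OF p] by (simp add: k_def)
    let ?D = "det (\<chi> i j. hess F p (X $ i) (X $ j)) :: real"
    let ?P = "(\<Psi> (adjoin e X))\<^sup>2"
    have "second_ff S (\<lambda>_. c *\<^sub>R e) p (X $ i) (X $ j) = (- 1 / k) * hess F p (X $ i) (X $ j)" for i j
      using second_ff_level[OF S p _ X X, of "\<lambda>_. c *\<^sub>R e" i j] dFN[OF p] k by (simp add: k_def)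
    then have "(\<chi> i j. second_ff S (\<lambda>_. c *\<^sub>R e) p (X $ i) (X $ j))
        = (\<chi> i. (- 1 / k) *s (\<chi> j. hess F p (X $ i) (X $ j)))"
      by (simp add: vec_eq_iff)
    then have "det (\<chi> i j. second_ff S (\<lambda>_. c *\<^sub>R e) p (X $ i) (X $ j)) = (- 1 / k) ^ ?n * ?D"
      using det_rows_mul[of "\<lambda>_. - 1 / k" "\<lambda>i. \<chi> j. hess F p (X $ i) (X $ j)"] by simp
    then have dh: "\<bar>det (\<chi> i j. second_ff S (\<lambda>_. c *\<^sub>R e) p (X $ i) (X $ j))\<bar> = \<bar>?D\<bar> / \<bar>k\<bar> ^ ?n"
      by (simp add: abs_mult power_abs power_divide)
    have H: "\<bar>hess_det \<Psi> F p\<bar> * ?P = lam\<^sup>2 * \<bar>r\<bar> * \<bar>?D\<bar>"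
      using arg_cong[OF hess_det_tangential[OF pU[OF p] X], of abs] Fp[OF p] by (simp add: abs_mult)
    have "sqrt \<bar>det (\<chi> i j. second_ff S (\<lambda>_. c *\<^sub>R e) p (X $ i) (X $ j))\<bar> = \<bar>\<Psi> (adjoin (c *\<^sub>R e) X)\<bar>
        \<longleftrightarrow> \<bar>?D\<bar> / \<bar>k\<bar> ^ ?n = (\<Psi> (adjoin (c *\<^sub>R e) X))\<^sup>2"
      unfolding dh real_sqrt_abs[symmetric, of "\<Psi> (adjoin (c *\<^sub>R e) X)"] by (rule real_sqrt_eq_iff)
    also have "\<dots> \<longleftrightarrow> \<bar>?D\<bar> = \<bar>k\<bar> ^ ?n * c\<^sup>2 * ?P"
      unfolding parallel_volume_form_adjoin_scale[OF \<Psi>] using k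
      by (simp add: power_mult_distrib nonzero_divide_eq_eq mult_ac)
    also have "\<dots> \<longleftrightarrow> lam\<^sup>2 * \<bar>r\<bar> * \<bar>?D\<bar> = lam\<^sup>2 * \<bar>r\<bar> * (\<bar>k\<bar> ^ ?n * c\<^sup>2 * ?P)"
      using lam r[OF p] by simp
    also have "lam\<^sup>2 * \<bar>r\<bar> * (\<bar>k\<bar> ^ ?n * c\<^sup>2 * ?P) = \<bar>c * lam\<bar> ^ (?n + 2) * \<bar>r\<bar> ^ (?n + 1) * ?P"
      unfolding k_def abs_mult power_add power_mult_distrib power2_abs by (simp add: mult_ac)
    finally show ?thesis unfolding H .
  qed
  show ?thesis
  proof
    assume eq: "equiaffine_normal \<Psi> S (\<lambda>_. c *\<^sub>R e)"
    show "\<forall>p\<in>S. \<bar>hess_det \<Psi> F p\<bar> = \<bar>c * lam\<bar> ^ (?n + 2) * \<bar>r\<bar> ^ (?n + 1)"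
    proof
      fix p assume p: "p \<in> S"
      obtain X :: "(real^('n option))^'n" where X: "\<And>i. dF p (X $ i) = 0" "\<Psi> (adjoin e X) \<noteq> 0"
        using tangent_basis[OF pU[OF p]] by metis
      have "\<forall>i. X $ i \<in> tangent_space S p" using X(1) by (simp add: tangent_space_level[OF S p])
      then have "sqrt \<bar>det (\<chi> i j. second_ff S (\<lambda>_. c *\<^sub>R e) p (X $ i) (X $ j))\<bar> = \<bar>\<Psi> (adjoin (c *\<^sub>R e) X)\<bar>"
        using eq p unfolding equiaffine_normal_def by blast
      then show "\<bar>hess_det \<Psi> F p\<bar> = \<bar>c * lam\<bar> ^ (?n + 2) * \<bar>r\<bar> ^ (?n + 1)"
        using key[OF p X(1)] X(2) by simp
    qed
  next
    assume H: "\<forall>p\<in>S. \<bar>hess_det \<Psi> F p\<bar> = \<bar>c * lam\<bar> ^ (?n + 2) * \<bar>r\<bar> ^ (?n + 1)"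
    show "equiaffine_normal \<Psi> S (\<lambda>_. c *\<^sub>R e)"
      unfolding equiaffine_normal_def
    proof (intro conjI ballI allI impI transverse_field_const[OF S c])
      fix p X assume "p \<in> S" "X \<in> tangent_space S p"
      then show "connection_form S (\<lambda>_. c *\<^sub>R e) p X = 0"
        using connection_form_const[OF S] dFN nz by metis
    next
      fix p and X :: "(real^('n option))^'n"
      assume p: "p \<in> S" and "\<forall>i. X $ i \<in> tangent_space S p"
      then have X: "dF p (X $ i) = 0" for i by (simp add: tangent_space_level[OF S p])
      show "sqrt \<bar>det (\<chi> i j. second_ff S (\<lambda>_. c *\<^sub>R e) p (X $ i) (X $ j))\<bar> = \<bar>\<Psi> (adjoin (c *\<^sub>R e) X)\<bar>"
        unfolding key[OF p X] using H p by simp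
    qed
  qed
qed

text \<open>If \<open>W\<close> is on the side on which \<open>dF\<close> is negative, its second fundamental form is a positive
  multiple of the Hessian.\<close>

lemma signature_second_ff:
  assumes S: "openin (top_of_set (level r)) S" and p: "p \<in> S" and W: "dF p (W p) < 0"
  shows "signature_on (second_ff S W p) (tangent_space S p) = signature_on (hess F p) {v. dF p v = 0}"
proof -
  have pU: "p \<in> U" using openin_imp_subset[OF S] p by (auto simp: level_iff)
  show ?thesis
    unfolding tangent_space_level[OF S p]
  proof (rule signature_on_cong_scale)
    show "- 1 / dF p (W p) > 0" using W by (simp add: divide_neg_neg)
    show "second_ff S W p u u = - 1 / dF p (W p) * hess F p u u" if "u \<in> {v. dF p v = 0}" for u
      using second_ff_level[where N = W, OF S p] W that by simp
  qed
qed

text \<open>A tangent vector in the radical of the Hessian on the tangent space is also orthogonal to the axis,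
  hence lies in the kernel of the full Hessian matrix.\<close>

lemma nondegenerate_level:
  assumes S: "openin (top_of_set (level r)) S" and nd: "\<And>p. p \<in> S \<Longrightarrow> hess_det \<Psi> F p \<noteq> 0"
  shows "nondegenerate_hypersurface S"
  unfolding nondegenerate_hypersurface_def
proof (intro conjI hypersurface_level[OF S] exI[of _ "\<lambda>_. e"] ballI impI)
  show "transverse_field S (\<lambda>_. e)" using transverse_field_const[OF S, of 1] by simp
  fix p X assume p: "p \<in> S" and "X \<in> tangent_space S p"
    and *: "\<forall>Y\<in>tangent_space S p. second_ff S (\<lambda>_. e) p X Y = 0"
  then have X: "dF p X = 0" by (simp add: tangent_space_level[OF S p])
  have pU: "p \<in> U" using openin_imp_subset[OF S] p by (auto simp: level_iff)
  note nz = dF_axis_nonzero[OF pU]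
  have 0: "hess F p X Y = 0" if "dF p Y = 0" for Y
  proof -
    have "Y \<in> tangent_space S p" using that by (simp add: tangent_space_level[OF S p])
    then have "- hess F p X Y / dF p e = 0"
      using * second_ff_level[where N = "\<lambda>_. e", OF S p nz X that] by simp
    then show ?thesis using nz by simp
  qed
  have b: "bilinear (hess F p)" by (rule bilinear_hess[OF pU])
  have "hess F p Y X = 0" for Y
  proof -
    define Z where "Z = Y - (dF p Y / dF p e) *\<^sub>R e"
    have "dF p Z = 0" using nz by (simp add: Z_def linear_diff[OF linear_dF[OF pU]] linear_cmul[OF linear_dF[OF pU]])
    then have "hess F p X Z = 0" by (rule 0)
    moreover have "hess F p X e = 0" using hess_commute[OF pU, of X e] hess_axis[OF pU, of X] X by simp
    ultimately have "hess F p X Y = 0" by (simp add: Z_def bilinear_rsub[OF b] bilinear_rmul[OF b])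
    then show ?thesis using hess_commute[OF pU] by simp
  qed
  then have "u \<bullet> (hess_matrix F p *v X) = 0" for u using hess_eq_matrix[OF pU] by simp
  then have "hess_matrix F p *v X = 0" by (metis inner_eq_zero_iff)
  moreover have "invertible (hess_matrix F p)"
    using nd[OF p] by (simp add: invertible_det_nz hess_det_eq_0_iff[OF pU])
  ultimately show "X = 0"
    by (metis inj_matrix_vector_mult injD matrix_vector_mult_0_right)
qed

end


section \<open>Improper affine spheres and the Hessian determinant equation\<close>

lemma transverse_field_cong:
  assumes "\<And>p. p \<in> S \<Longrightarrow> N p = N' p"
  shows "transverse_field S N \<longleftrightarrow> transverse_field S N'"
  unfolding transverse_field_def using smooth_along_cong[OF assms] assms by auto

context translationally_homogeneous_volume
begin

definition coorientation :: "real^('n option) \<Rightarrow> real^('n option)"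
  where "coorientation = (\<lambda>x. - sgn (norm2_differential F x) *\<^sub>R raised_differential F x)"

lemma coorientation_eq:
  assumes "p \<in> level r" "hess_det \<Psi> F p \<noteq> 0"
  shows "coorientation p = (- sgn r / lam) *\<^sub>R e"
  using assms norm2_differential_eq[of p] raised_differential_eq[of p] hess_det_eq_0_iff[of p]
  by (simp add: coorientation_def level_iff)

lemma dF_coorientation:
  assumes "p \<in> level r" "hess_det \<Psi> F p \<noteq> 0"
  shows "dF p (coorientation p) < 0"
proof -
  have p: "p \<in> U" "F p = r" "r \<noteq> 0" using assms F_nonzero by (auto simp: level_iff)
  have "dF p (coorientation p) = - \<bar>r\<bar>"
    unfolding coorientation_eq[OF assms] linear_cmul[OF linear_dF[OF p(1)]] dF_axis[OF p(1)]
    using p lam by (simp add: abs_sgn[of r] mult.commute)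
  then show ?thesis using p(3) by simp
qed

lemma signature_mod_4_eq_iff:
  assumes p: "p \<in> level r" "hess_det \<Psi> F p \<noteq> 0" and q: "q \<in> level r" "hess_det \<Psi> F q \<noteq> 0"
    and W: "dF p (W p) < 0" "dF q (W q) < 0"
  shows "signature_on (second_ff (level r) W p) (tangent_space (level r) p) mod 4 =
      signature_on (second_ff (level r) W q) (tangent_space (level r) q) mod 4 \<longleftrightarrow>
    sgn (hess_det \<Psi> F p) = sgn (hess_det \<Psi> F q)"
proof -
  have S: "openin (top_of_set (level r)) (level r)" by simp
  have U: "p \<in> U" "q \<in> U" and r: "F p = r" "F q = r" "r \<noteq> 0"
    using p q F_nonzero by (auto simp: level_iff)
  obtain i where i: "signature_on (hess F p) {v. dF p v = 0} = int CARD('n) - 2 * int i"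
    "sgn (hess_det \<Psi> F p) = sgn (F p) * (-1) ^ i"
    using tangent_basis[OF U(1)] p(2) by metis
  obtain j where j: "signature_on (hess F q) {v. dF q v = 0} = int CARD('n) - 2 * int j"
    "sgn (hess_det \<Psi> F q) = sgn (F q) * (-1) ^ j"
    using tangent_basis[OF U(2)] q(2) by metis
  show ?thesis
    unfolding signature_second_ff[where W = W, OF S p(1) W(1)] signature_second_ff[where W = W, OF S q(1) W(2)]
      i j mod_4_of_signature_eq_iff r
    using r(3) by (simp add: sgn_zero_iff)
qed

text \<open>The constant value of \<open>H(F)\<close> determines \<open>\<bar>c\<bar>\<close> through its absolute value, the coorientation
  determines the sign of \<open>c\<close>, and the constant sign of \<open>H(F)\<close> gives the agreement of signatures.\<close>

lemma improper_affine_sphere_if_constant_hess_det: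
  assumes r: "r \<noteq> 0" and h: "h \<noteq> 0" "\<And>p. p \<in> level r \<Longrightarrow> hess_det \<Psi> F p = h"
  shows "cooriented_improper_affine_sphere \<Psi> (level r) coorientation"
    and "\<exists>c. cooriented_equiaffine_normal \<Psi> (level r) coorientation (\<lambda>_. c *\<^sub>R e)"
proof -
  let ?n = "CARD('n)"
  let ?S = "level r"
  have S: "openin (top_of_set ?S) ?S" by simp
  \<comment> \<open>The value of \<open>\<bar>c \<lambda>\<bar>\<close> that the normalization of the equiaffine normal requires.\<close>
  define a where "a = root (?n + 2) (\<bar>h\<bar> / \<bar>r\<bar> ^ (?n + 1))"
  have a: "a > 0" "a ^ (?n + 2) = \<bar>h\<bar> / \<bar>r\<bar> ^ (?n + 1)"
    unfolding a_def by (rule real_root_gt_zero; use r h(1) in simp)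
      (rule real_root_pow_pos; use r h(1) in simp)
  define c where "c = - sgn r * a / lam"
  have "c * lam * r = - (a * (r * sgn r))" using lam by (simp add: c_def)
  then have "c * lam * r = - (a * \<bar>r\<bar>)" by (simp only: abs_sgn)
  moreover have "a * \<bar>r\<bar> > 0" using a(1) r by simp
  ultimately have neg: "c * lam * r < 0" by linarith
  have c: "c \<noteq> 0" "\<bar>c * lam\<bar> = a"
    using r a(1) lam by (auto simp: c_def abs_mult abs_sgn_eq sgn_zero_iff)
  have dens: "\<bar>c * lam\<bar> ^ (?n + 2) * \<bar>r\<bar> ^ (?n + 1) = \<bar>h\<bar>"
    unfolding c(2) a(2) using r by simp
  have nd: "hess_det \<Psi> F p \<noteq> 0" if "p \<in> ?S" for p using h that by simp
  have equi: "equiaffine_normal \<Psi> C (\<lambda>_. c *\<^sub>R e)" if "openin (top_of_set ?S) C" for C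
    unfolding equiaffine_normal_axis_iff[OF that c(1)] dens
    using h(2) openin_imp_subset[OF that] by blast
  have par: "parallel_along C (\<lambda>_. c *\<^sub>R e)" for C
    unfolding parallel_along_def by (intro exI[of _ e]) (simp add: span_mul span_base)
  have cons: "consistent_with ?S coorientation (\<lambda>_. c *\<^sub>R e)"
    unfolding consistent_with_def
  proof
    fix p assume p: "p \<in> ?S"
    have "c *\<^sub>R e - a *\<^sub>R coorientation p = 0"
      by (simp add: coorientation_eq[OF p nd[OF p]] c_def)
    moreover have "0 \<in> tangent_space ?S p"
      using p linear_0[OF linear_dF] by (simp add: tangent_space_level[OF S p] level_iff)
    ultimately show "\<exists>a>0. c *\<^sub>R e - a *\<^sub>R coorientation p \<in> tangent_space ?S p"
      using a(1) by (intro exI[of _ a]) simp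
  qed
  show *: "\<exists>c. cooriented_equiaffine_normal \<Psi> ?S coorientation (\<lambda>_. c *\<^sub>R e)"
    unfolding cooriented_equiaffine_normal_def using equi[OF S] cons by blast
  have "connected_improper_affine_sphere \<Psi> C" if C: "C \<in> components ?S" for C
    unfolding connected_improper_affine_sphere_def
    using in_components_connected[OF C] nondegenerate_level[OF openin_component_level[OF C]]
      nd in_components_subset[OF C] equi[OF openin_component_level[OF C]] par by blast
  moreover have "transverse_field ?S coorientation"
  proof -
    have "transverse_field ?S coorientation \<longleftrightarrow> transverse_field ?S (\<lambda>_. (- sgn r / lam) *\<^sub>R e)"
      by (rule transverse_field_cong) (rule coorientation_eq[OF _ nd])
    then show ?thesis
      using transverse_field_const[OF S, of "- sgn r / lam"] r lam by (simp add: sgn_zero_iff)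
  qed
  moreover have "dF p (c *\<^sub>R e) < 0" if "p \<in> ?S" for p
    using that neg by (auto simp: level_iff linear_cmul[OF linear_dF] dF_axis mult.assoc)
  then have "signature_on (second_ff ?S (\<lambda>_. c *\<^sub>R e) p) (tangent_space ?S p) mod 4 =
      signature_on (second_ff ?S (\<lambda>_. c *\<^sub>R e) q) (tangent_space ?S q) mod 4" if "p \<in> ?S" "q \<in> ?S" for p q
    using that h signature_mod_4_eq_iff[of p r q "\<lambda>_. c *\<^sub>R e"] by simp
  ultimately show "cooriented_improper_affine_sphere \<Psi> ?S coorientation"
    unfolding cooriented_improper_affine_sphere_def cooriented_equiaffine_normal_def
    using hypersurface_level[OF S] equi[OF S] cons par by blast
qed

text \<open>The absolute value of the Hessian determinant is read off from the constant equiaffine normal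
  \<open>c e\<close>. The signature condition may refer to another normal \<open>W\<close>, but consistency with the
  coorientation makes its form \<open>h\<close> a positive multiple of the Hessian as well.\<close>

lemma hess_det_constant_if_improper_affine_sphere:
  assumes sphere: "cooriented_improper_affine_sphere \<Psi> (level r) coorientation"
    and normal: "cooriented_equiaffine_normal \<Psi> (level r) coorientation (\<lambda>_. c *\<^sub>R e)"
    and p: "p \<in> level r" and q: "q \<in> level r"
  shows "hess_det \<Psi> F p \<noteq> 0" and "hess_det \<Psi> F p = hess_det \<Psi> F q"
proof -
  let ?S = "level r"
  have S: "openin (top_of_set ?S) ?S" by simp
  have r: "r \<noteq> 0" using p F_nonzero by (auto simp: level_iff)
  have normal': "equiaffine_normal \<Psi> ?S (\<lambda>_. c *\<^sub>R e)"
    using normal by (simp add: cooriented_equiaffine_normal_def)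
  have "c *\<^sub>R e \<notin> tangent_space ?S p"
    using normal' p by (simp add: equiaffine_normal_def transverse_field_def)
  then have c: "c \<noteq> 0"
    using p linear_0[OF linear_dF] by (auto simp: tangent_space_level[OF S p] level_iff)
  have abs: "\<bar>hess_det \<Psi> F x\<bar> = \<bar>c * lam\<bar> ^ (CARD('n) + 2) * \<bar>r\<bar> ^ (CARD('n) + 1)" if "x \<in> ?S" for x
    using normal' that unfolding equiaffine_normal_axis_iff[OF S c] by blast
  have nd: "hess_det \<Psi> F x \<noteq> 0" if "x \<in> ?S" for x
    using abs[OF that] c lam r by auto
  show "hess_det \<Psi> F p \<noteq> 0" by (rule nd[OF p])
  obtain W where W: "consistent_with ?S coorientation W"
    "\<forall>p\<in>?S. \<forall>q\<in>?S. signature_on (second_ff ?S W p) (tangent_space ?S p) mod 4 =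
           signature_on (second_ff ?S W q) (tangent_space ?S q) mod 4"
    using sphere unfolding cooriented_improper_affine_sphere_def cooriented_equiaffine_normal_def
    by blast
  have neg: "dF x (W x) < 0" if x: "x \<in> ?S" for x
  proof -
    have xU: "x \<in> U" using x by (simp add: level_iff)
    obtain a where a: "a > 0" "W x - a *\<^sub>R coorientation x \<in> tangent_space ?S x"
      using W(1) x unfolding consistent_with_def by blast
    then have "dF x (W x) = a * dF x (coorientation x)"
      by (simp add: tangent_space_level[OF S x] linear_diff[OF linear_dF[OF xU]] linear_cmul[OF linear_dF[OF xU]])
    then show ?thesis
      using a(1) dF_coorientation[OF x nd[OF x]] by (simp add: mult_pos_neg)
  qed
  have "sgn (hess_det \<Psi> F p) = sgn (hess_det \<Psi> F q)"
    using signature_mod_4_eq_iff[where W = W, OF p nd[OF p] q nd[OF q] neg[OF p] neg[OF q]] W(2) p q by blast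
  moreover have "\<bar>hess_det \<Psi> F p\<bar> = \<bar>hess_det \<Psi> F q\<bar>" using abs p q by simp
  ultimately show "hess_det \<Psi> F p = hess_det \<Psi> F q" by (metis mult_sgn_abs)
qed

text \<open>Sliding along the axis changes the value of \<open>F\<close> continuously and shows that
  \<open>\<phi>(r) / r\<^sup>n\<^sup>+\<^sup>1\<close> is locally constant on the set of values of \<open>F\<close>.\<close>

lemma hess_det_power_law:
  assumes H: "\<And>x. x \<in> U \<Longrightarrow> hess_det \<Psi> F x = \<phi> (F x)"
    and J: "connected J" "J \<subseteq> F ` U" and ab: "a \<in> J" "b \<in> J"
  shows "\<phi> a / a ^ (CARD('n) + 1) = \<phi> b / b ^ (CARD('n) + 1)"
proof (rule connected_local_const[OF J(1) ab, of "\<lambda>r. \<phi> r / r ^ (CARD('n) + 1)"], intro ballI)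
  fix a assume "a \<in> J"
  then obtain x where x: "x \<in> U" "F x = a" using J by blast
  then have a: "a \<noteq> 0" using F_nonzero by blast
  have "((\<lambda>b. x + (ln (b / a) / lam) *\<^sub>R e) \<longlongrightarrow> x + (ln (a / a) / lam) *\<^sub>R e) (at a within J)"
    using a lam by (intro tendsto_intros) auto
  then have "eventually (\<lambda>b. x + (ln (b / a) / lam) *\<^sub>R e \<in> U) (at a within J)"
    using a x open_U by (auto dest: topological_tendstoD)
  moreover have "((\<lambda>b. b / a) \<longlongrightarrow> a / a) (at a within J)"
    using a by (intro tendsto_intros) auto
  then have "eventually (\<lambda>b. b / a > 0) (at a within J)"
    using a order_tendstoD(1) by fastforce
  ultimately show "\<forall>\<^sub>F b in at a within J. \<phi> a / a ^ (CARD('n) + 1) = \<phi> b / b ^ (CARD('n) + 1)"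
  proof eventually_elim
    case (elim b)
    let ?t = "ln (b / a) / lam"
    have exp: "exp (lam * ?t) = b / a" using elim lam by simp
    have "F (x + ?t *\<^sub>R e) = b"
      using F_translate[OF x(1) elim(1)] exp x a by simp
    then have "\<phi> b = (b / a) ^ (CARD('n) + 1) * \<phi> a"
      using hess_det_translate[OF \<Psi> x(1) elim(1)] H[OF elim(1)] H[OF x(1)] x(2) exp by simp
    moreover have "b \<noteq> 0" using elim by auto
    ultimately show ?case using a by (simp add: field_simps power_divide)
  qed
qed

end

theorem theorem2p3:
  fixes \<Psi> :: "(real^('n::finite option))^('n option) \<Rightarrow> real"
    and F :: "real^('n option) \<Rightarrow> real"
    and \<Omega> :: "(real^('n option)) set"
    and e :: "real^('n option)"
    and I :: "real set"
    and lam :: real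
  assumes "parallel_volume_form \<Psi>"
    and "lam \<noteq> 0"
    and "open \<Omega>" and "\<Omega> \<noteq> {}"
    and "open I" and "connected I" and "I \<noteq> {}" and "0 \<notin> I"
    and "F \<in> A_class lam \<Omega>"
    and "is_axis lam \<Omega> F e"
  shows
    "((\<exists>\<phi>. solves_hess_det_eq \<Psi> F \<Omega> I \<phi>) \<longleftrightarrow>
      (\<forall>r\<in>I.
         let \<Sigma> = level_set F (preimage_region F \<Omega> I) r;
             V = (\<lambda>x. - sgn (norm2_differential F x) *\<^sub>R raised_differential F x)
         in cooriented_improper_affine_sphere \<Psi> \<Sigma> V \<and>
            (\<exists>c. cooriented_equiaffine_normal \<Psi> \<Sigma> V (\<lambda>_. c *\<^sub>R e))))
     \<and> (\<forall>\<phi>. solves_hess_det_eq \<Psi> F \<Omega> I \<phi> \<longrightarrow>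
          (\<forall>J. connected J \<and> J \<subseteq> F ` preimage_region F \<Omega> I \<longrightarrow>
             (\<exists>\<kappa>. \<kappa> \<noteq> 0 \<and> (\<forall>r\<in>J. \<phi> r = \<kappa> * r ^ (CARD('n) + 1)))))"
proof -
  define U where "U = preimage_region F \<Omega> I"
  have U_eq: "U = \<Omega> \<inter> F -` I" by (auto simp: U_def preimage_region_def)
  have FA: "continuous_on \<Omega> F" "smooth_on F (\<Omega> - {x. F x = 0})"
    using assms(9) by (auto simp: A_class_def)
  interpret translationally_homogeneous_volume F U e lam \<Psi>
  proof
    show "open U" unfolding U_eq by (rule continuous_open_preimage[OF FA(1) assms(3,5)])
    have "U \<subseteq> \<Omega> - {x. F x = 0}" using assms(8) by (auto simp: U_eq)
    then show "smooth_on F U" using FA(2) Ck_on_subset unfolding smooth_on_def by blast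
    show "F x \<noteq> 0" if "x \<in> U" for x using that assms(8) by (auto simp: U_eq)
    show "is_axis lam U F e" using assms(10) by (auto simp: is_axis_def U_eq)
  qed (use assms in auto)
  have solves: "solves_hess_det_eq \<Psi> F \<Omega> I \<phi> \<longleftrightarrow>
      (\<forall>r\<in>I. \<phi> r \<noteq> 0) \<and> (\<forall>x\<in>U. hess_det \<Psi> F x = \<phi> (F x))" for \<phi>
    by (simp add: solves_hess_det_eq_def U_def)
  have FI: "F x \<in> I" if "x \<in> U" for x using that by (simp add: U_eq)
  define spheres where "spheres \<longleftrightarrow> (\<forall>r\<in>I. cooriented_improper_affine_sphere \<Psi> (level r) coorientation \<and>
    (\<exists>c. cooriented_equiaffine_normal \<Psi> (level r) coorientation (\<lambda>_. c *\<^sub>R e)))"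
  have "spheres" if \<phi>: "solves_hess_det_eq \<Psi> F \<Omega> I \<phi>" for \<phi>
    unfolding spheres_def
  proof
    fix r assume r: "r \<in> I"
    have "r \<noteq> 0" "\<phi> r \<noteq> 0" "hess_det \<Psi> F p = \<phi> r" if "p \<in> level r" for p
      using \<phi> r that assms(8) by (auto simp: solves level_iff)
    moreover have "r \<noteq> 0" "\<phi> r \<noteq> 0" using \<phi> r assms(8) by (auto simp: solves)
    ultimately show "cooriented_improper_affine_sphere \<Psi> (level r) coorientation \<and>
        (\<exists>c. cooriented_equiaffine_normal \<Psi> (level r) coorientation (\<lambda>_. c *\<^sub>R e))"
      using improper_affine_sphere_if_constant_hess_det[of r "\<phi> r"] by blast
  qed
  moreover have "\<exists>\<phi>. solves_hess_det_eq \<Psi> F \<Omega> I \<phi>" if spheres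
  proof -
    have const: "hess_det \<Psi> F p \<noteq> 0" "hess_det \<Psi> F p = hess_det \<Psi> F q"
      if "p \<in> U" "q \<in> U" "F p = F q" for p q
    proof -
      have "p \<in> level (F q)" "q \<in> level (F q)" using that by (auto simp: level_iff)
      then show "hess_det \<Psi> F p \<noteq> 0" "hess_det \<Psi> F p = hess_det \<Psi> F q"
        using \<open>spheres\<close> FI[OF that(2)] hess_det_constant_if_improper_affine_sphere
        unfolding spheres_def by blast+
    qed
    define \<phi> where "\<phi> r = (if level r = {} then 1 else hess_det \<Psi> F (SOME p. p \<in> level r))" for r
    have some: "(SOME p. p \<in> level r) \<in> level r" if "level r \<noteq> {}" for r
      using that by (simp add: some_in_eq)
    have "\<phi> r \<noteq> 0" for r
      using some[of r] const(1) by (auto simp: \<phi>_def level_iff)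
    moreover have "hess_det \<Psi> F x = \<phi> (F x)" if "x \<in> U" for x
    proof -
      have "x \<in> level (F x)" using that by (simp add: level_iff)
      then have ne: "level (F x) \<noteq> {}" by blast
      then show ?thesis
        using some[OF ne] const(2)[OF that] by (simp add: \<phi>_def level_iff)
    qed
    ultimately show ?thesis unfolding solves by blast
  qed
  moreover have "\<exists>\<kappa>. \<kappa> \<noteq> 0 \<and> (\<forall>r\<in>J. \<phi> r = \<kappa> * r ^ (CARD('n) + 1))"
    if \<phi>: "solves_hess_det_eq \<Psi> F \<Omega> I \<phi>" and J: "connected J" "J \<subseteq> F ` U" for \<phi> J
  proof (cases "J = {}")
    case False
    then obtain a where a: "a \<in> J" by blast
    have JI: "r \<in> I" "r \<noteq> 0" if mem: "r \<in> J" for r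
    proof -
      obtain x where "x \<in> U" "r = F x" using mem J(2) by blast
      then show "r \<in> I" "r \<noteq> 0" using FI F_nonzero by simp_all
    qed
    have "\<phi> r = \<phi> a / a ^ (CARD('n) + 1) * r ^ (CARD('n) + 1)" if "r \<in> J" for r
    proof -
      have "\<phi> a / a ^ (CARD('n) + 1) = \<phi> r / r ^ (CARD('n) + 1)"
        by (rule hess_det_power_law[OF _ J a that]) (use \<phi> in \<open>simp add: solves\<close>)
      then show ?thesis using JI(2)[OF that] by simp
    qed
    moreover have "\<phi> a / a ^ (CARD('n) + 1) \<noteq> 0" using \<phi> JI[OF a] by (simp add: solves)
    ultimately show ?thesis by blast
  qed (auto intro: exI[of _ 1])
  ultimately show ?thesis
    unfolding Let_def spheres_def coorientation_def U_def by blast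
qed

end
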